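(* Let $L>2$. Under Assumptions (A1)–(A4) (stated in the context), there exists a universal constant $C>0$ such that for all $n\ge N(d,t_0,\tilde\theta,\delta_0,\eta_0)$, $$ P\left(h(\widehat\pi_n,\pi_0)>L\,\frac{(\log(nd))^{1+d/2}}{\sqrt n}\right)\le \frac{1}{(L^2/2-2)^2(\log(nd))^{2+d}}+\frac{C}{L}\,\frac{d\,3^{d}}{(\log(1/t_0))^{1+d/2}}\left(1+\frac{1}{(\log(1/t_0))^{1+d/2}}\right). $$ In particular, $h(\widehat\pi_n,\pi_0)=O_{\mathbb P}\big((\log(nd))^{1+d/2}/\sqrt n\big)$.
   Context: Power series distributions (PSDs): let $b_k\ge0$ with $b_k>0$ for every $k\in\mathbb N=\{0,1,2,\dots\}$, and $b(\theta)=\sum_{k\ge0}b_k\theta^k$ with radius of convergence $R\in(0,\infty]$. Let $\mathcal T=[0,R]$ if $b(R)<\infty$ and $\mathcal T=[0,R)$ if $b(R)=\infty$ (so $\mathcal T=[0,\infty)$ if $R=\infty$). For $\theta\in\mathcal T$, $f_\theta(k)=b_k\theta^k/b(\theta)$, $k\in\mathbb N$. Fix a dimension $d\ge1$ and let $\Theta=\mathcal T^d$. The true pmf on $\mathbb N^d$ is $\pi_0(\mathbf k)=\int_\Theta\prod_{j=1}^d f_{\theta_j}(k_j)\,dQ_0(\theta_1,\dots,\theta_d)$, $\mathbf k=(k_1,\dots,k_d)$, where $Q_0$ is an unknown probability measure on $\Theta$. Let $\mathbf X_1,\dots,\mathbf X_n$ be i.i.d. with pmf $\pi_0$. The nonparametric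 MLE $\widehat Q_n$ is a maximizer over all probability measures $Q$ on $\Theta$ of $\prod_{i=1}^n\int_\Theta\prod_{j=1}^d f_{\theta_j}(X_{ij})\,dQ(\boldsymbol\theta)$, and $\widehat\pi_n(\mathbf k)=\int_\Theta\prod_{j}f_{\theta_j}(k_j)\,d\widehat Q_n(\boldsymbol\theta)$. Hellinger distance: $h^2(\pi_1,\pi_2)=\frac12\sum_{\mathbf k\in\mathbb N^d}(\sqrt{\pi_1(\mathbf k)}-\sqrt{\pi_2(\mathbf k)})^2$. Assumptions: (A1) If $R<\infty$, there is $q_0\in(0,1)$ with $\mathrm{supp}\,Q_0\subseteq[0,q_0R]^d$; if $R=\infty$, there is $M>0$ with $\mathrm{supp}\,Q_0\subseteq[0,M]^d$. (A2) If $Q_0(\{(0,\dots,0)\})>0$, there exist $\eta_0\in(0,1)$ and $\delta_0\in(0,R)$ with $Q_0(\{(0,\dots,0)\})\le1-\eta_0$ and $\mathrm{supp}\,Q_0\cap\bigcup_{j=1}^d\{\boldsymbol\theta:\theta_j\in(0,\delta_0)\}=\varnothing$; if $Q_0(\{(0,\dots,0)\})=0$, there is $\delta_0\in(0,R)$ with $\mathrm{supp}\,Q_0\cap\bigcup_{j=1}^d\{\boldsymbol\theta:\theta_j\in(0,\delta_0)\}=\varnothing$ (in this case $\eta_0$ denotes an arbitrary fixed number in $(0,1]$). (A3) There is $V\in\mathbb N$ with $b_k/b_0\ge k^{-k}$ for all $k\ge V$. (A4) $\lim_{k\to\infty}b_{k+1}/b_k$ exists in $[0,\infty)$. Constants: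 $t_0=\frac{q_0+1}{2}$ and $\tilde\theta=q_0R$ if $R<\infty$; $t_0=\frac12$ and $\tilde\theta=M$ if $R=\infty$. $U=\lfloor\tilde\theta\sup_{\theta\in(0,\tilde\theta)}b'(\theta)/b(\theta)\rfloor+1$, $W=\min\{w\ge3:\sup_{k\ge w}b_{k+1}/b_k\le t_0/\tilde\theta\}$, and $N(d,t_0,\tilde\theta,\delta_0,\eta_0)=\Big\lfloor\frac1d\exp\Big\{\log\big(\tfrac{1}{\sqrt{t_0}}\big)\cdot\Big(U\vee V\vee W\vee\frac{b(\delta_0)}{b_0\eta_0^{1/d}}\vee\frac{1}{\delta_0^{1/d}}\Big)\Big\}\vee\frac{1}{t_0^{W-1}(1-t_0)}\Big\rfloor+1.$ *)

theory Defs
  imports "HOL-Analysis.Analysis" "HOL-Probability.Probability"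
begin

definition psd_sum :: "(nat \<Rightarrow> real) \<Rightarrow> real \<Rightarrow> real" where
  "psd_sum b \<theta> = (\<Sum>k. b k * \<theta> ^ k)"

definition psd_T :: "(nat \<Rightarrow> real) \<Rightarrow> real set" where
  "psd_T b = {\<theta>. 0 \<le> \<theta> \<and> (ereal \<theta> < conv_radius b \<or>
      (ereal \<theta> = conv_radius b \<and> summable (\<lambda>k. b k * \<theta> ^ k)))}"

definition psd_pmf :: "(nat \<Rightarrow> real) \<Rightarrow> real \<Rightarrow> nat \<Rightarrow> real" where
  "psd_pmf b \<theta> k = b k * \<theta> ^ k / psd_sum b \<theta>"

definition param_space :: "nat \<Rightarrow> (nat \<Rightarrow> real) measure" where
  "param_space d = PiM {..<d} (\<lambda>_. lborel)"

definition admissible_mixing :: "nat \<Rightarrow> (nat \<Rightarrow> real) \<Rightarrow> (nat \<Rightarrow> real) measure \<Rightarrow> bool" where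
  "admissible_mixing d b Q \<longleftrightarrow> prob_space Q \<and> sets Q = sets (param_space d) \<and>
     (AE \<theta> in Q. \<forall>j<d. \<theta> j \<in> psd_T b)"

definition mix_pmf :: "nat \<Rightarrow> (nat \<Rightarrow> real) \<Rightarrow> (nat \<Rightarrow> real) measure \<Rightarrow> nat list \<Rightarrow> real" where
  "mix_pmf d b Q ks = (if length ks = d
     then integral\<^sup>L Q (\<lambda>\<theta>. \<Prod>j<d. psd_pmf b (\<theta> j) (ks ! j)) else 0)"

definition hellinger :: "nat \<Rightarrow> (nat list \<Rightarrow> real) \<Rightarrow> (nat list \<Rightarrow> real) \<Rightarrow> real" where
  "hellinger d p1 p2 = sqrt ((1/2) * infsum (\<lambda>ks. (sqrt (p1 ks) - sqrt (p2 ks))^2) {ks. length ks = d})"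

definition likelihood :: "nat \<Rightarrow> (nat \<Rightarrow> real) \<Rightarrow> nat \<Rightarrow> (nat \<Rightarrow> nat list) \<Rightarrow> (nat \<Rightarrow> real) measure \<Rightarrow> real" where
  "likelihood d b n X Q = (\<Prod>i<n. mix_pmf d b Q (X i))"

definition is_npmle :: "nat \<Rightarrow> (nat \<Rightarrow> real) \<Rightarrow> nat \<Rightarrow> (nat \<Rightarrow> nat list) \<Rightarrow> (nat \<Rightarrow> real) measure \<Rightarrow> bool" where
  "is_npmle d b n X Q \<longleftrightarrow> admissible_mixing d b Q \<and>
     (\<forall>Q'. admissible_mixing d b Q' \<longrightarrow> likelihood d b n X Q' \<le> likelihood d b n X Q)"

definition sample_pmf :: "nat \<Rightarrow> (nat \<Rightarrow> real) \<Rightarrow> (nat \<Rightarrow> real) measure \<Rightarrow> nat \<Rightarrow> (nat \<Rightarrow> nat list) pmf" where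
  "sample_pmf d b Q0 n = Pi_pmf {..<n} [] (\<lambda>_. embed_pmf (mix_pmf d b Q0))"

definition theta_tilde :: "(nat \<Rightarrow> real) \<Rightarrow> real \<Rightarrow> real \<Rightarrow> real" where
  "theta_tilde b q0 M = (if conv_radius b = \<infinity> then M else q0 * real_of_ereal (conv_radius b))"

definition t0_const :: "(nat \<Rightarrow> real) \<Rightarrow> real \<Rightarrow> real" where
  "t0_const b q0 = (if conv_radius b = \<infinity> then 1/2 else (q0 + 1) / 2)"

definition U_const :: "(nat \<Rightarrow> real) \<Rightarrow> real \<Rightarrow> real" where
  "U_const b \<theta>t = real_of_int \<lfloor>\<theta>t * (SUP \<theta>\<in>{0<..<\<theta>t}. deriv (psd_sum b) \<theta> / psd_sum b \<theta>)\<rfloor> + 1"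

(* sup_{k>=w} b_{k+1}/b_k <= c  written out as  forall k>=w. b_{k+1}/b_k <= c *)
definition W_const :: "(nat \<Rightarrow> real) \<Rightarrow> real \<Rightarrow> real \<Rightarrow> nat" where
  "W_const b t0 \<theta>t = (LEAST w::nat. 3 \<le> w \<and> (\<forall>k\<ge>w. b (Suc k) / b k \<le> t0 / \<theta>t))"

definition N_const :: "nat \<Rightarrow> (nat \<Rightarrow> real) \<Rightarrow> real \<Rightarrow> real \<Rightarrow> real \<Rightarrow> real \<Rightarrow> nat \<Rightarrow> real" where
  "N_const d b t0 \<theta>t \<delta>0 \<eta>0 V =
     (let U = U_const b \<theta>t; W = W_const b t0 \<theta>t in
      real_of_int \<lfloor>max ((1 / real d) * exp (ln (1 / sqrt t0) *
            max (max (max (max U (real V)) (real W)) (psd_sum b \<delta>0 / (b 0 * \<eta>0 powr (1 / real d))))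
                (1 / \<delta>0 powr (1 / real d))))
          (1 / (t0 ^ (W - 1) * (1 - t0)))\<rfloor> + 1)"

definition psd_assumptions ::
  "nat \<Rightarrow> (nat \<Rightarrow> real) \<Rightarrow> (nat \<Rightarrow> real) measure \<Rightarrow> real \<Rightarrow> real \<Rightarrow> real \<Rightarrow> real \<Rightarrow> nat \<Rightarrow> bool" where
  "psd_assumptions d b Q0 q0 M \<delta>0 \<eta>0 V \<longleftrightarrow>
     1 \<le> d \<and> (\<forall>k. 0 < b k) \<and> 0 < conv_radius b \<and> admissible_mixing d b Q0 \<and>
     \<comment> \<open>(A1): supp Q0 contained in the closed box, i.e. the complement has Q0-measure 0\<close>
     (if conv_radius b < \<infinity>
      then 0 < q0 \<and> q0 < 1 \<and>
        measure Q0 {\<theta> \<in> space Q0. \<not> (\<forall>j<d. \<theta> j \<in> {0 .. q0 * real_of_ereal (conv_radius b)})} = 0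
      else 0 < M \<and> measure Q0 {\<theta> \<in> space Q0. \<not> (\<forall>j<d. \<theta> j \<in> {0 .. M})} = 0) \<and>
     \<comment> \<open>(A2): supp Q0 disjoint from the open set, i.e. the open set has Q0-measure 0\<close>
     0 < \<delta>0 \<and> ereal \<delta>0 < conv_radius b \<and> 0 < \<eta>0 \<and> \<eta>0 \<le> 1 \<and>
     (measure Q0 {\<theta> \<in> space Q0. \<forall>j<d. \<theta> j = 0} > 0 \<longrightarrow>
        \<eta>0 < 1 \<and> measure Q0 {\<theta> \<in> space Q0. \<forall>j<d. \<theta> j = 0} \<le> 1 - \<eta>0) \<and>
     measure Q0 {\<theta> \<in> space Q0. \<exists>j<d. \<theta> j \<in> {0<..<\<delta>0}} = 0 \<and>
     \<comment> \<open>(A3)\<close>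
     (\<forall>k\<ge>V. b k / b 0 \<ge> 1 / real k ^ k) \<and>
     \<comment> \<open>(A4)\<close>
     (\<exists>l. (\<lambda>k. b (Suc k) / b k) \<longlonglongrightarrow> l)"

end

theory Submission
  imports Defs
begin

text \<open>
  Comparing the likelihoods of the maximizer and of the true mixture, and using
  \<open>x \<le> exp (x - 1)\<close>, shows that the empirical mean of \<open>sqrt (p / p0) - 1\<close> is nonnegative,
  where \<open>p\<close> is the fitted and \<open>p0\<close> the true pmf. If all observations lie in a finite part \<open>B\<close>
  of the support of \<open>p0\<close>, Cauchy--Schwarz then bounds the squared Hellinger distance \<open>h\<^sup>2\<close> by
  \<open>sqrt (2 \<chi>\<^sup>2) h + p0 (- B)\<close>, where \<open>\<chi>\<^sup>2\<close> is Pearson's statistic on \<open>B\<close>, whose expectation is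
  at most \<open>card B / n\<close>.
  For \<open>B\<close> the box of side \<open>m\<close> of order \<open>5 log (n d) / (2 log (1 / t0))\<close>, the geometric decay of the
  component tails makes \<open>n p0 (- B)\<close> at most \<open>1 / sqrt n\<close>. Since \<open>h \<le> 1\<close>, only \<open>L < sqrt n\<close>
  matters, so this term is absorbed in \<open>C / L\<close>; the constant \<open>C = 8\<close> makes \<open>L \<le> 8\<close> trivial.
\<close>

subsection \<open>Maximum likelihood and Hellinger distance for probability mass functions\<close>

lemma expectation_Pi_pmf_component:
  fixes f :: "'a \<Rightarrow> real"
  assumes "finite I" "i \<in> I"
  shows "measure_pmf.expectation (Pi_pmf I dflt (\<lambda>_. P)) (\<lambda>X. f (X i)) = measure_pmf.expectation P f"
proof -
  have "map_pmf (\<lambda>X. X i) (Pi_pmf I dflt (\<lambda>_. P)) = P"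
    using Pi_pmf_component[OF assms(1), of i dflt "\<lambda>_. P"] assms(2) by simp
  then show ?thesis
    using integral_map_pmf[of "\<lambda>X. X i" "Pi_pmf I dflt (\<lambda>_. P)" f] by simp
qed

text \<open>Independence and centring kill every off-diagonal term of the expanded square. The
  uniform bound \<open>c\<close> makes all products integrable, so expectation and sums may be
  exchanged.\<close>

lemma second_moment_sum_Pi_pmf:
  fixes f :: "'a \<Rightarrow> real"
  assumes bound: "\<And>x. \<bar>f x\<bar> \<le> c" and mean: "measure_pmf.expectation P f = 0"
  shows "measure_pmf.expectation (Pi_pmf {..<n} dflt (\<lambda>_. P)) (\<lambda>X. (\<Sum>i<n. f (X i))\<^sup>2)
    = real n * measure_pmf.expectation P (\<lambda>x. (f x)\<^sup>2)"
proof -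
  let ?M = "Pi_pmf {..<n} dflt (\<lambda>_. P)"
  have int: "integrable ?M (\<lambda>X. f (X i) * f (X j))" for i j
    by (rule measure_pmf.integrable_const_bound[where B = "c * c"])
       (auto simp: abs_mult intro!: mult_mono bound order.trans[OF abs_ge_zero bound])
  have int1: "integrable ?M (\<lambda>X. f (X i))" for i
    by (rule measure_pmf.integrable_const_bound[where B = c]) (auto simp: bound)
  have cov: "measure_pmf.expectation ?M (\<lambda>X. f (X i) * f (X j)) =
    (if i = j then measure_pmf.expectation P (\<lambda>x. (f x)\<^sup>2) else 0)" if "i < n" "j < n" for i j
  proof (cases "i = j")
    case True
    then show ?thesis
      using expectation_Pi_pmf_component[of "{..<n}" i dflt P "\<lambda>x. (f x)\<^sup>2"] that
      by (simp add: power2_eq_square)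
  next
    case False
    have "prob_space.indep_vars ?M (\<lambda>_. borel) (\<lambda>k X. f (X k)) {..<n}"
      using prob_space.indep_vars_compose2[OF measure_pmf.prob_space_axioms,
          OF indep_vars_Pi_pmf[of "{..<n}" dflt "\<lambda>_. P"], of "\<lambda>_. f" "\<lambda>_. borel"] by simp
    then have "prob_space.indep_vars ?M (\<lambda>_. borel) (\<lambda>k X. f (X k)) {i, j}"
      by (rule prob_space.indep_vars_subset[OF measure_pmf.prob_space_axioms]) (use that in auto)
    then have "measure_pmf.expectation ?M (\<lambda>X. \<Prod>k\<in>{i, j}. f (X k))
      = (\<Prod>k\<in>{i, j}. measure_pmf.expectation ?M (\<lambda>X. f (X k)))"
      by (intro prob_space.indep_vars_lebesgue_integral) (auto intro: int1 measure_pmf.prob_space_axioms)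
    then show ?thesis
      using False that expectation_Pi_pmf_component[of "{..<n}" _ dflt P f] mean by simp
  qed
  have "measure_pmf.expectation ?M (\<lambda>X. (\<Sum>i<n. f (X i))\<^sup>2)
    = measure_pmf.expectation ?M (\<lambda>X. \<Sum>i<n. \<Sum>j<n. f (X i) * f (X j))"
    by (simp add: power2_eq_square sum_product)
  also have "\<dots> = (\<Sum>i<n. \<Sum>j<n. measure_pmf.expectation ?M (\<lambda>X. f (X i) * f (X j)))"
    by (simp add: int)
  also have "\<dots> = (\<Sum>i<n. \<Sum>j<n. if i = j then measure_pmf.expectation P (\<lambda>x. (f x)\<^sup>2) else 0)"
    by (intro sum.cong) (auto simp: cov)
  finally show ?thesis by simp
qed

section \<open>Empirical frequencies and Pearson's statistic\<close>

definition emp_freq :: "nat \<Rightarrow> (nat \<Rightarrow> 'a) \<Rightarrow> 'a \<Rightarrow> real" where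
  "emp_freq n X k = (\<Sum>i<n. indicator {k} (X i)) / real n"

text \<open>Pearson's statistic on the cells \<open>B\<close>, without its usual factor
  \<open>n\<close>. A cell of probability zero contributes 0, since division by zero yields
  0.\<close>

definition chi_square :: "nat \<Rightarrow> 'a pmf \<Rightarrow> 'a set \<Rightarrow> (nat \<Rightarrow> 'a) \<Rightarrow> real" where
  "chi_square n P B X = (\<Sum>k\<in>B. (emp_freq n X k - pmf P k)\<^sup>2 / pmf P k)"

lemma chi_square_nonneg: "chi_square n P B X \<ge> 0"
  by (auto simp: chi_square_def intro!: sum_nonneg)

text \<open>Each observation falls in exactly one cell of \<open>B\<close>, so regrouping by cells
  loses nothing. This moves between sample averages and sums against \<open>pmf P\<close>.\<close>

lemma sum_emp_freq_mult:
  assumes "finite B" "\<And>i. i < n \<Longrightarrow> X i \<in> B"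
  shows "(\<Sum>k\<in>B. emp_freq n X k * g k) = (\<Sum>i<n. g (X i)) / real n"
proof -
  have "(\<Sum>k\<in>B. emp_freq n X k * g k) = (\<Sum>k\<in>B. \<Sum>i<n. indicator {k} (X i) * g k / real n)"
    by (simp add: emp_freq_def sum_distrib_right sum_divide_distrib)
  also have "\<dots> = (\<Sum>i<n. \<Sum>k\<in>B. indicator {k} (X i) * g k / real n)"
    by (rule sum.swap)
  also have "\<dots> = (\<Sum>i<n. g (X i) / real n)"
  proof (rule sum.cong[OF refl])
    fix i assume "i \<in> {..<n}"
    then have "(\<Sum>k\<in>B. indicator {k} (X i) * g k / real n)
      = (\<Sum>k\<in>B. if X i = k then g k / real n else 0)"
      by (intro sum.cong) (auto simp: indicator_def)
    then show "(\<Sum>k\<in>B. indicator {k} (X i) * g k / real n) = g (X i) / real n"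
      using assms \<open>i \<in> {..<n}\<close> by simp
  qed
  finally show ?thesis by (simp add: sum_divide_distrib)
qed

text \<open>For a cell of probability \<open>p > 0\<close>, the empirical frequency has variance
  \<open>p * (1 - p) / n\<close>; division by \<open>p\<close> leaves at most \<open>1 / n\<close>.
  The bound thus depends on the number of cells only, however small their probabilities are.\<close>

lemma expectation_chi_square_le:
  assumes "finite B" and "n > 0"
  shows "measure_pmf.expectation (Pi_pmf {..<n} dflt (\<lambda>_. P)) (chi_square n P B) \<le> real (card B) / real n"
    and "integrable (Pi_pmf {..<n} dflt (\<lambda>_. P)) (chi_square n P B)"
proof -
  let ?M = "Pi_pmf {..<n} dflt (\<lambda>_. P)"
  define f where "f k x = indicator {k} x - pmf P k" for k x
  have fb: "\<bar>f k x\<bar> \<le> 1" for k x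
    using pmf_le_1[of P k] by (auto simp: f_def indicator_def)
  have mean: "measure_pmf.expectation P (f k) = 0" for k
    unfolding f_def by (subst Bochner_Integration.integral_diff)
       (auto simp: pmf.rep_eq measure_pmf.emeasure_eq_measure)
  have sq: "measure_pmf.expectation P (\<lambda>x. (f k x)\<^sup>2) = pmf P k * (1 - pmf P k)" for k
  proof -
    \<comment> \<open>The indicator equals its own square, so the squared deviation is affine in
      it.\<close>
    have "(\<lambda>x. (f k x)\<^sup>2) = (\<lambda>x. (1 - 2 * pmf P k) * indicator {k} x + (pmf P k)\<^sup>2)"
      by (auto simp: f_def indicator_def power2_eq_square algebra_simps fun_eq_iff)
    then have "measure_pmf.expectation P (\<lambda>x. (f k x)\<^sup>2) = (1 - 2 * pmf P k) * pmf P k + (pmf P k)\<^sup>2"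
      by (simp add: pmf.rep_eq measure_pmf.emeasure_eq_measure)
    then show ?thesis by (simp add: power2_eq_square algebra_simps)
  qed
  have dev: "emp_freq n X k - pmf P k = (\<Sum>i<n. f k (X i)) / real n" for X k
    using \<open>n > 0\<close> by (simp add: emp_freq_def f_def sum_subtractf field_simps)
  have chi: "chi_square n P B = (\<lambda>X. \<Sum>k\<in>B. (\<Sum>i<n. f k (X i))\<^sup>2 * (1 / ((real n)\<^sup>2 * pmf P k)))"
    by (auto simp: chi_square_def dev power_divide fun_eq_iff)
  have int: "integrable ?M (\<lambda>X. (\<Sum>i<n. f k (X i))\<^sup>2)" for k
  proof (rule measure_pmf.integrable_const_bound[where B = "(real n)\<^sup>2"])
    have "\<bar>\<Sum>i<n. f k (X i)\<bar> \<le> real n" for X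
      using sum_norm_bound[of "{..<n}" "\<lambda>i. f k (X i)" 1] fb by simp
    then have "(\<Sum>i<n. f k (X i))\<^sup>2 \<le> (real n)\<^sup>2" for X
      by (simp add: abs_le_square_iff[symmetric])
    then show "AE X in ?M. norm ((\<Sum>i<n. f k (X i))\<^sup>2) \<le> (real n)\<^sup>2"
      by simp
  qed auto
  show "integrable ?M (chi_square n P B)"
    unfolding chi by (intro Bochner_Integration.integrable_sum integrable_mult_left int)
  have "measure_pmf.expectation ?M (chi_square n P B)
    = (\<Sum>k\<in>B. measure_pmf.expectation ?M (\<lambda>X. (\<Sum>i<n. f k (X i))\<^sup>2) * (1 / ((real n)\<^sup>2 * pmf P k)))"
    unfolding chi by (subst Bochner_Integration.integral_sum) (auto intro!: int)
  also have "\<dots> = (\<Sum>k\<in>B. real n * (pmf P k * (1 - pmf P k)) * (1 / ((real n)\<^sup>2 * pmf P k)))"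
    using second_moment_sum_Pi_pmf[OF fb mean] by (simp add: sq)
  also have "\<dots> \<le> (\<Sum>k\<in>B. 1 / real n)"
  proof (rule sum_mono)
    fix k
    show "real n * (pmf P k * (1 - pmf P k)) * (1 / ((real n)\<^sup>2 * pmf P k)) \<le> 1 / real n"
      using \<open>n > 0\<close> pmf_nonneg[of P k] by (cases "pmf P k = 0") (auto simp: power2_eq_square field_simps)
  qed
  finally show "measure_pmf.expectation ?M (chi_square n P B) \<le> real (card B) / real n" by simp
qed

section \<open>The Hellinger distance of probability mass functions\<close>

definition hell_pmf :: "'a pmf \<Rightarrow> 'a pmf \<Rightarrow> 'a set \<Rightarrow> real" where
  "hell_pmf p q A = sqrt ((1/2) * infsum (\<lambda>k. (sqrt (pmf p k) - sqrt (pmf q k))\<^sup>2) A)"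

text \<open>Expand the squares over \<open>F \<union> B\<close>: both masses are at most 1, and
  dropping the products outside \<open>B\<close> only increases the bound. Keeping \<open>F\<close>
  and \<open>B\<close> independent lets \<open>F\<close> exhaust an infinite set while
  \<open>B\<close> stays fixed.\<close>

lemma sum_sqrt_diff_square_le:
  assumes "finite F" "finite B"
  shows "(\<Sum>k\<in>F. (sqrt (pmf p k) - sqrt (pmf q k))\<^sup>2) \<le> 2 - 2 * (\<Sum>k\<in>B. sqrt (pmf p k * pmf q k))"
proof -
  have "(\<Sum>k\<in>F. (sqrt (pmf p k) - sqrt (pmf q k))\<^sup>2) \<le> (\<Sum>k\<in>F\<union>B. (sqrt (pmf p k) - sqrt (pmf q k))\<^sup>2)"
    using assms by (intro sum_mono2) auto
  also have "\<dots> = (\<Sum>k\<in>F\<union>B. pmf p k) + (\<Sum>k\<in>F\<union>B. pmf q k) - 2 * (\<Sum>k\<in>F\<union>B. sqrt (pmf p k * pmf q k))"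
    by (simp add: power2_diff sum.distrib sum_subtractf sum_distrib_left real_sqrt_mult mult.assoc)
  also have "\<dots> \<le> 1 + 1 - 2 * (\<Sum>k\<in>B. sqrt (pmf p k * pmf q k))"
  proof -
    have "(\<Sum>k\<in>F\<union>B. pmf r k) \<le> 1" for r :: "'a pmf"
      using assms by (simp add: measure_measure_pmf_finite[symmetric])
    moreover have "(\<Sum>k\<in>B. sqrt (pmf p k * pmf q k)) \<le> (\<Sum>k\<in>F\<union>B. sqrt (pmf p k * pmf q k))"
      using assms by (intro sum_mono2) auto
    ultimately show ?thesis by (smt (verit))
  qed
  finally show ?thesis by simp
qed

lemma
  shows hell_pmf_nonneg: "hell_pmf p q A \<ge> 0"
    and hell_pmf_square_le: "finite B \<Longrightarrow> (hell_pmf p q A)\<^sup>2 \<le> 1 - (\<Sum>k\<in>B. sqrt (pmf p k * pmf q k))"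
    and hell_pmf_square_ge: "finite B \<Longrightarrow> B \<subseteq> A \<Longrightarrow>
      (\<Sum>k\<in>B. (sqrt (pmf p k) - sqrt (pmf q k))\<^sup>2) \<le> 2 * (hell_pmf p q A)\<^sup>2"
    and hell_pmf_le_1: "hell_pmf p q A \<le> 1"
proof -
  let ?f = "\<lambda>k. (sqrt (pmf p k) - sqrt (pmf q k))\<^sup>2"
  have nonneg: "infsum ?f A \<ge> 0" by (rule infsum_nonneg) simp
  have eq: "(hell_pmf p q A)\<^sup>2 = (1/2) * infsum ?f A"
    using nonneg by (simp add: hell_pmf_def)
  show h0: "hell_pmf p q A \<ge> 0"
    using nonneg by (simp add: hell_pmf_def)
  \<comment> \<open>With an empty \<open>B\<close> the finite sums are bounded by 2, which suffices
    for summability of nonnegative terms.\<close>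
  have summable: "?f summable_on A"
    by (rule nonneg_bdd_above_summable_on)
       (auto intro!: bdd_aboveI2[where M = 2] order.trans[OF sum_sqrt_diff_square_le[where B = "{}"]])
  show *: "(hell_pmf p q A)\<^sup>2 \<le> 1 - (\<Sum>k\<in>B. sqrt (pmf p k * pmf q k))" if "finite B" for B
  proof -
    have "infsum ?f A \<le> 2 - 2 * (\<Sum>k\<in>B. sqrt (pmf p k * pmf q k))"
      by (rule infsum_le_finite_sums[OF summable]) (rule sum_sqrt_diff_square_le, simp, rule that)
    then show ?thesis by (simp add: eq)
  qed
  show "(\<Sum>k\<in>B. ?f k) \<le> 2 * (hell_pmf p q A)\<^sup>2" if "finite B" "B \<subseteq> A" for B
    using finite_sum_le_infsum[OF summable that] by (simp add: eq)
  show "hell_pmf p q A \<le> 1"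
    using *[of "{}"] h0 by (simp add: power_le_one_iff abs_square_le_1)
qed

text \<open>Meant for likelihood ratios at the observations. The square root of their product is
  still at least 1, and each factor obeys \<open>x \<le> exp (x - 1)\<close>. Working with
  exponentials instead of logarithms admits ratios equal to zero.\<close>

lemma sum_sqrt_ratio_ge:
  fixes r :: "nat \<Rightarrow> real"
  assumes "\<And>i. i < n \<Longrightarrow> r i \<ge> 0" and "(\<Prod>i<n. r i) \<ge> 1"
  shows "(\<Sum>i<n. sqrt (r i)) \<ge> real n"
proof -
  have "1 \<le> sqrt (\<Prod>i<n. r i)" using assms(2) by simp
  also have "\<dots> = (\<Prod>i<n. sqrt (r i))" by (induction n) (simp_all add: real_sqrt_mult)
  also have "\<dots> \<le> (\<Prod>i<n. exp (sqrt (r i) - 1))"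
  proof (rule prod_mono)
    fix i assume "i \<in> {..<n}"
    then show "0 \<le> sqrt (r i) \<and> sqrt (r i) \<le> exp (sqrt (r i) - 1)"
      using assms(1) exp_ge_add_one_self[of "sqrt (r i) - 1"] by simp
  qed
  also have "\<dots> = exp (\<Sum>i<n. sqrt (r i) - 1)" by (simp add: exp_sum)
  finally show ?thesis by (simp add: sum_subtractf)
qed

text \<open>The Hellinger distance occurs on both sides: the sampling error is paired with
  \<open>g - 1\<close>, where \<open>g\<close> is the square root of the likelihood ratio, and the
  norm of \<open>g - 1\<close> weighted by \<open>P\<close> is itself at most a multiple of the
  distance. Hence the error enters linearly against a square on the left.\<close>

lemma mle_hellinger_basic_inequality:
  assumes "finite B" "B \<subseteq> set_pmf P" "B \<subseteq> A" "n > 0"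
    and X: "\<And>i. i < n \<Longrightarrow> X i \<in> B"
    and lik: "(\<Prod>i<n. pmf P (X i)) \<le> (\<Prod>i<n. pmf Ph (X i))"
  shows "(hell_pmf Ph P A)\<^sup>2 \<le> sqrt (2 * chi_square n P B X) * hell_pmf Ph P A + measure_pmf.prob P (- B)"
proof -
  let ?h = "hell_pmf Ph P A"
  define g where "g k = sqrt (pmf Ph k / pmf P k)" for k
  define e where "e k = emp_freq n X k" for k
  have pos: "pmf P k > 0" if "k \<in> B" for k
    using that assms(2) by (auto simp: set_pmf_iff pmf_positive_iff)
  have "(\<Prod>i<n. pmf Ph (X i) / pmf P (X i)) \<ge> 1"
    using lik prod_pos[of "{..<n}" "\<lambda>i. pmf P (X i)"] pos X by (simp add: prod_dividef)
  then have "real n \<le> (\<Sum>i<n. g (X i))"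
    unfolding g_def by (intro sum_sqrt_ratio_ge) auto
  then have eg: "1 \<le> (\<Sum>k\<in>B. e k * g k)"
    using \<open>n > 0\<close> unfolding e_def by (subst sum_emp_freq_mult[OF assms(1) X]) auto
  have e1: "(\<Sum>k\<in>B. e k) = 1"
    using sum_emp_freq_mult[where X = X and g = "\<lambda>_. 1", OF assms(1) X] \<open>n > 0\<close> by (simp add: e_def)
  have PB: "(\<Sum>k\<in>B. pmf P k) = 1 - measure_pmf.prob P (- B)"
    using assms(1) measure_pmf.prob_compl[of B P] by (simp add: measure_measure_pmf_finite Compl_eq_Diff_UNIV)
  have "?h\<^sup>2 \<le> 1 - (\<Sum>k\<in>B. sqrt (pmf Ph k * pmf P k))"
    by (rule hell_pmf_square_le[OF assms(1)])
  also have "(\<Sum>k\<in>B. sqrt (pmf Ph k * pmf P k)) = (\<Sum>k\<in>B. pmf P k * g k)"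
  proof (rule sum.cong[OF refl])
    fix k assume "k \<in> B"
    have "y\<^sup>2 * (z / y) = z * y" if "y \<noteq> 0" for y z :: real
      using that by (simp add: power2_eq_square)
    from this[of "sqrt (pmf P k)" "sqrt (pmf Ph k)"]
    have "pmf P k * (sqrt (pmf Ph k) / sqrt (pmf P k)) = sqrt (pmf Ph k) * sqrt (pmf P k)"
      using pos[OF \<open>k \<in> B\<close>] by simp
    then have "pmf P k * g k = sqrt (pmf Ph k * pmf P k)"
      by (simp add: g_def real_sqrt_divide real_sqrt_mult)
    then show "sqrt (pmf Ph k * pmf P k) = pmf P k * g k" ..
  qed
  \<comment> \<open>By \<open>eg\<close> the left side is at most the sum of
    \<open>(e k - pmf P k) * g k\<close>. Centring \<open>g\<close> at 1 leaves the sum of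
    \<open>e k - pmf P k\<close>, which is the mass of \<open>P\<close> outside
    \<open>B\<close>.\<close>
  also have "1 - (\<Sum>k\<in>B. pmf P k * g k) \<le> (\<Sum>k\<in>B. (e k - pmf P k) * (g k - 1)) + measure_pmf.prob P (- B)"
    using eg e1 PB by (simp add: algebra_simps sum.distrib sum_subtractf)
  also have "(\<Sum>k\<in>B. (e k - pmf P k) * (g k - 1)) \<le> sqrt (2 * chi_square n P B X) * ?h"
  proof -
    \<comment> \<open>The weight \<open>sqrt (pmf P k)\<close> is divided out of one factor and put
      into the other, so that Cauchy-Schwarz produces Pearson's statistic and the Hellinger
      summands.\<close>
    have "(\<Sum>k\<in>B. (e k - pmf P k) * (g k - 1))
      = (\<Sum>k\<in>B. ((e k - pmf P k) / sqrt (pmf P k)) * (sqrt (pmf P k) * (g k - 1)))"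
    proof (rule sum.cong[OF refl])
      fix k assume "k \<in> B"
      then have "sqrt (pmf P k) \<noteq> 0" using pos[of k] by simp
      then show "(e k - pmf P k) * (g k - 1)
        = ((e k - pmf P k) / sqrt (pmf P k)) * (sqrt (pmf P k) * (g k - 1))" by simp
    qed
    then have "(\<Sum>k\<in>B. (e k - pmf P k) * (g k - 1))\<^sup>2
      \<le> (\<Sum>k\<in>B. ((e k - pmf P k) / sqrt (pmf P k))\<^sup>2) * (\<Sum>k\<in>B. (sqrt (pmf P k) * (g k - 1))\<^sup>2)"
      by (simp only: Cauchy_Schwarz_ineq_sum)
    also have "(\<Sum>k\<in>B. ((e k - pmf P k) / sqrt (pmf P k))\<^sup>2) = chi_square n P B X"
      by (simp add: chi_square_def e_def power_divide)
    also have "(\<Sum>k\<in>B. (sqrt (pmf P k) * (g k - 1))\<^sup>2) = (\<Sum>k\<in>B. (sqrt (pmf Ph k) - sqrt (pmf P k))\<^sup>2)"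
    proof (rule sum.cong[OF refl])
      fix k assume "k \<in> B"
      then have "sqrt (pmf P k) \<noteq> 0" using pos[of k] by simp
      then have "sqrt (pmf P k) * (g k - 1) = sqrt (pmf Ph k) - sqrt (pmf P k)"
        by (simp add: g_def real_sqrt_divide right_diff_distrib)
      then show "(sqrt (pmf P k) * (g k - 1))\<^sup>2 = (sqrt (pmf Ph k) - sqrt (pmf P k))\<^sup>2" by simp
    qed
    also have "chi_square n P B X * \<dots> \<le> chi_square n P B X * (2 * ?h\<^sup>2)"
      by (intro mult_left_mono hell_pmf_square_ge assms) (rule chi_square_nonneg)
    finally have "(\<Sum>k\<in>B. (e k - pmf P k) * (g k - 1))\<^sup>2 \<le> 2 * chi_square n P B X * ?h\<^sup>2"
      by (simp add: ac_simps)
    then have "(\<Sum>k\<in>B. (e k - pmf P k) * (g k - 1)) \<le> sqrt (2 * chi_square n P B X * ?h\<^sup>2)"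
      by (rule real_le_rsqrt)
    then show ?thesis by (simp add: real_sqrt_mult hell_pmf_nonneg)
  qed
  finally show ?thesis by simp
qed

text \<open>Either some observation leaves \<open>B\<close>, which the union bound controls, or the
  basic inequality applies. In the second case \<open>tail\<close> lets the mass outside
  \<open>B\<close> be absorbed as a quarter of the squared distance, so a distance above
  \<open>s\<close> forces a large Pearson statistic, and Markov's inequality finishes.\<close>

lemma mle_hellinger_deviation:
  assumes B: "finite B" "B \<subseteq> set_pmf P" "B \<subseteq> A" and "n > 0" and "s > 0"
    and tail: "4 * measure_pmf.prob P (- B) \<le> s\<^sup>2"
    and lik: "\<And>X. X \<in> set_pmf (Pi_pmf {..<n} dflt (\<lambda>_. P)) \<Longrightarrow>
      (\<Prod>i<n. pmf P (X i)) \<le> (\<Prod>i<n. pmf (Ph X) (X i))"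
  shows "measure_pmf.prob (Pi_pmf {..<n} dflt (\<lambda>_. P)) {X. hell_pmf (Ph X) P A > s}
    \<le> real n * measure_pmf.prob P (- B) + 4 * real (card B) / (real n * s\<^sup>2)"
proof -
  let ?M = "Pi_pmf {..<n} dflt (\<lambda>_. P)"
  let ?T = "\<lambda>i. {X. X i \<notin> B}" and ?E = "{X \<in> space ?M. chi_square n P B X \<ge> s\<^sup>2 / 4}"
  \<comment> \<open>The likelihood comparison is available only on the support of the sample law,
    hence the intersection.\<close>
  have sub: "{X. hell_pmf (Ph X) P A > s} \<inter> set_pmf ?M \<subseteq> (\<Union>i<n. ?T i) \<union> ?E"
  proof
    fix X assume X: "X \<in> {X. hell_pmf (Ph X) P A > s} \<inter> set_pmf ?M"
    show "X \<in> (\<Union>i<n. ?T i) \<union> ?E"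
    proof (cases "\<forall>i<n. X i \<in> B")
      case True
      define h where "h = hell_pmf (Ph X) P A"
      have "h > s" using X by (simp add: h_def)
      define c where "c = sqrt (2 * chi_square n P B X)"
      have "h\<^sup>2 \<le> c * h + measure_pmf.prob P (- B)"
        unfolding h_def c_def
        using X True by (intro mle_hellinger_basic_inequality B lik \<open>n > 0\<close>) auto
      also have "measure_pmf.prob P (- B) \<le> h\<^sup>2 / 4"
        using tail power_mono[of s h 2] \<open>h > s\<close> \<open>s > 0\<close> by linarith
      finally have "h * (3 * h) \<le> h * (4 * c)" by (simp add: power2_eq_square algebra_simps)
      then have "3 * h \<le> 4 * c"
        using \<open>h > s\<close> \<open>s > 0\<close> by simp
      then have "3 * s \<le> 4 * c" using \<open>h > s\<close> by simp
      then have "(3 * s)\<^sup>2 \<le> (4 * c)\<^sup>2"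
        using \<open>s > 0\<close> by (intro power_mono) auto
      moreover have "c\<^sup>2 = 2 * chi_square n P B X"
        unfolding c_def by (simp add: chi_square_nonneg)
      ultimately have "9 * s\<^sup>2 \<le> 32 * chi_square n P B X"
        by (simp add: power_mult_distrib)
      moreover have "s\<^sup>2 \<ge> 0" by simp
      \<comment> \<open>The constant 9/32 is rounded down to 1/4.\<close>
      ultimately have "s\<^sup>2 \<le> 4 * chi_square n P B X" by linarith
      then show ?thesis by simp
    qed auto
  qed
  have "measure_pmf.prob ?M {X. hell_pmf (Ph X) P A > s}
    = measure_pmf.prob ?M ({X. hell_pmf (Ph X) P A > s} \<inter> set_pmf ?M)"
    by (simp add: measure_Int_set_pmf)
  also have "\<dots> \<le> measure_pmf.prob ?M ((\<Union>i<n. ?T i) \<union> ?E)"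
    by (intro measure_pmf.finite_measure_mono sub) auto
  also have "\<dots> \<le> measure_pmf.prob ?M (\<Union>i<n. ?T i) + measure_pmf.prob ?M ?E"
    by (intro measure_Un_le) auto
  also have "measure_pmf.prob ?M (\<Union>i<n. ?T i) \<le> (\<Sum>i<n. measure_pmf.prob ?M (?T i))"
    by (intro measure_pmf.finite_measure_subadditive_finite) auto
  also have "\<dots> = (\<Sum>i<n. measure_pmf.prob P (- B))"
  proof (rule sum.cong[OF refl])
    fix i assume "i \<in> {..<n}"
    then have "map_pmf (\<lambda>X. X i) ?M = P"
      using Pi_pmf_component[of "{..<n}" i dflt "\<lambda>_. P"] by simp
    moreover have "measure_pmf.prob ?M (?T i) = measure_pmf.prob (map_pmf (\<lambda>X. X i) ?M) (- B)"
      by (simp add: measure_map_pmf vimage_def)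
    ultimately show "measure_pmf.prob ?M (?T i) = measure_pmf.prob P (- B)" by simp
  qed
  also have "measure_pmf.prob ?M ?E \<le> measure_pmf.expectation ?M (chi_square n P B) / (s\<^sup>2 / 4)"
    using \<open>s > 0\<close> expectation_chi_square_le(2)[OF B(1) \<open>n > 0\<close>]
    by (intro integral_Markov_inequality_measure[where A = "{}"])
       (auto simp: chi_square_nonneg)
  also have "\<dots> \<le> (real (card B) / real n) / (s\<^sup>2 / 4)"
    using \<open>s > 0\<close> expectation_chi_square_le(1)[OF B(1) \<open>n > 0\<close>] by (intro divide_right_mono) auto
  finally show ?thesis by (simp add: mult.commute)
qed

subsection \<open>Mixtures of power series distributions\<close>

text \<open>Tonelli for sums over lists, by splitting off the head. The integrand vanishes at the
  empty list when the length is a successor, so only the image of the cons map matters, and that is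
  in bijection with pairs.\<close>

lemma nn_integral_list_prod:
  fixes g :: "nat \<Rightarrow> 'a \<Rightarrow> ennreal"
  shows "(\<integral>\<^sup>+ ks. (if length ks = d then \<Prod>j<d. g j (ks ! j) else 0) \<partial>count_space UNIV)
    = (\<Prod>j<d. \<integral>\<^sup>+ k. g j k \<partial>count_space UNIV)"
proof (induction d arbitrary: g)
  case 0
  show ?case
    by (subst nn_integral_count_space'[where A = "{[]}"]) auto
next
  case (Suc d)
  let ?F = "\<lambda>ks :: 'a list. if length ks = Suc d then \<Prod>j<Suc d. g j (ks ! j) else 0"
  let ?c = "\<lambda>(k, ks). k # ks :: 'a list"
  have "(\<integral>\<^sup>+ ks. ?F ks \<partial>count_space UNIV) = (\<integral>\<^sup>+ ks. ?F ks \<partial>count_space (range ?c))"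
    by (rule nn_integral_count_space_eq) (auto simp: image_iff length_Suc_conv)
  also have "\<dots> = (\<integral>\<^sup>+ p. ?F (?c p) \<partial>count_space UNIV)"
    by (rule nn_integral_bij_count_space[symmetric]) (auto simp: bij_betw_def inj_on_def)
  also have "\<dots> = (\<integral>\<^sup>+ k. \<integral>\<^sup>+ ks. ?F (k # ks) \<partial>count_space UNIV \<partial>count_space UNIV)"
    by (subst nn_integral_fst_count_space[symmetric]) (simp only: split_conv)
  also have "\<dots> = (\<integral>\<^sup>+ k. g 0 k * (\<integral>\<^sup>+ ks. (if length ks = d then \<Prod>j<d. g (Suc j) (ks ! j) else 0)
      \<partial>count_space UNIV) \<partial>count_space UNIV)"
    by (subst nn_integral_cmult[symmetric])
       (auto intro!: nn_integral_cong simp: prod.lessThan_Suc_shift simp del: prod.lessThan_Suc)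
  also have "\<dots> = (\<integral>\<^sup>+ k. g 0 k \<partial>count_space UNIV)
      * (\<Prod>j<d. \<integral>\<^sup>+ k. g (Suc j) k \<partial>count_space UNIV)"
    by (simp add: Suc.IH[of "\<lambda>j. g (Suc j)"] nn_integral_multc)
  finally show ?case by (simp add: prod.lessThan_Suc_shift del: prod.lessThan_Suc)
qed

section \<open>The component distributions\<close>

lemma psd_summable:
  assumes "\<theta> \<in> psd_T b"
  shows "summable (\<lambda>k. b k * \<theta> ^ k)"
  using assms summable_in_conv_radius[of \<theta> b] by (auto simp: psd_T_def)

lemma
  assumes pos: "\<And>k. 0 < b k" and \<theta>: "\<theta> \<in> psd_T b"
  shows psd_sum_pos: "0 < psd_sum b \<theta>"
    and psd_pmf_nonneg: "0 \<le> psd_pmf b \<theta> k"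
    and psd_pmf_le_1: "psd_pmf b \<theta> k \<le> 1"
    and psd_pmf_sums: "psd_pmf b \<theta> sums 1"
proof -
  have "0 \<le> \<theta>" using \<theta> by (simp add: psd_T_def)
  then have nonneg: "0 \<le> b k * \<theta> ^ k" for k using pos[of k] by simp
  have le: "b k * \<theta> ^ k \<le> psd_sum b \<theta>" for k
    using sum_le_suminf[OF psd_summable[OF \<theta>], of "{k}"] nonneg by (simp add: psd_sum_def)
  show p: "0 < psd_sum b \<theta>"
    using le[of 0] pos[of 0] by simp
  show "0 \<le> psd_pmf b \<theta> k" "psd_pmf b \<theta> k \<le> 1"
    using nonneg[of k] le[of k] p by (auto simp: psd_pmf_def)
  have "(\<lambda>k. b k * \<theta> ^ k / psd_sum b \<theta>) sums (psd_sum b \<theta> / psd_sum b \<theta>)"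
    unfolding psd_sum_def by (intro sums_divide summable_sums psd_summable \<theta>)
  then show "psd_pmf b \<theta> sums 1"
    using p by (simp add: psd_pmf_def[abs_def])
qed

lemma measurable_psd_pmf [measurable]: "(\<lambda>\<theta>. psd_pmf b \<theta> k) \<in> borel_measurable borel"
  unfolding psd_pmf_def psd_sum_def by measurable

lemma measurable_param_component:
  assumes "sets Q = sets (param_space d)" "j < d"
  shows "(\<lambda>\<theta>. \<theta> j) \<in> borel_measurable Q"
proof -
  have "(\<lambda>\<theta>. \<theta> j) \<in> borel_measurable (param_space d)"
    unfolding param_space_def using assms(2) measurable_component_singleton[of j "{..<d}" "\<lambda>_. lborel"]
    by simp
  then show ?thesis
    using assms(1) measurable_cong_sets by blast
qed

lemma measurable_psd_pmf_component:
  assumes "sets Q = sets (param_space d)" "j < d"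
  shows "(\<lambda>\<theta>. psd_pmf b (\<theta> j) k) \<in> borel_measurable Q"
  using measurable_compose[OF measurable_param_component[OF assms] measurable_psd_pmf] .

section \<open>The mixture as a probability mass function\<close>

context
  fixes d b Q
  assumes pos: "\<And>k. 0 < b k" and adm: "admissible_mixing d b Q"
begin

text \<open>The integrand lies in [0, 1] almost everywhere, so the Bochner integral agrees with the
  nonnegative one. The latter can be exchanged with sums over lists without integrability
  conditions.\<close>

lemma mix_pmf_nn_integral:
  "ennreal (mix_pmf d b Q ks)
    = (\<integral>\<^sup>+ \<theta>. (if length ks = d then \<Prod>j<d. ennreal (psd_pmf b (\<theta> j) (ks ! j)) else 0) \<partial>Q)"
proof (cases "length ks = d")
  case True
  interpret prob_space Q using adm by (simp add: admissible_mixing_def)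
  let ?f = "\<lambda>\<theta>. \<Prod>j<d. psd_pmf b (\<theta> j) (ks ! j)"
  have meas: "?f \<in> borel_measurable Q"
    using adm by (intro borel_measurable_prod measurable_psd_pmf_component)
      (auto simp: admissible_mixing_def)
  have AE: "AE \<theta> in Q. \<forall>j<d. \<theta> j \<in> psd_T b"
    using adm by (simp add: admissible_mixing_def)
  have "integrable Q ?f"
  proof (rule integrable_const_bound[where B = 1])
    show "AE \<theta> in Q. norm (?f \<theta>) \<le> 1"
      using AE by eventually_elim (auto intro!: prod_le_1 simp: abs_prod psd_pmf_nonneg psd_pmf_le_1 pos)
  qed (rule meas)
  moreover have nonneg: "AE \<theta> in Q. 0 \<le> ?f \<theta>"
    using AE by eventually_elim (auto intro!: prod_nonneg psd_pmf_nonneg pos)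
  ultimately have "ennreal (integral\<^sup>L Q ?f) = (\<integral>\<^sup>+ \<theta>. ennreal (?f \<theta>) \<partial>Q)"
    by (rule nn_integral_eq_integral[symmetric])
  also have "\<dots> = (\<integral>\<^sup>+ \<theta>. (\<Prod>j<d. ennreal (psd_pmf b (\<theta> j) (ks ! j))) \<partial>Q)"
    using AE by (intro nn_integral_cong_AE, eventually_elim)
      (auto intro!: prod_ennreal[symmetric] psd_pmf_nonneg pos)
  finally show ?thesis using True by (simp add: mix_pmf_def)
qed (simp add: mix_pmf_def)

lemma mix_pmf_nonneg: "0 \<le> mix_pmf d b Q ks"
proof -
  have "AE \<theta> in Q. \<forall>j<d. \<theta> j \<in> psd_T b"
    using adm by (simp add: admissible_mixing_def)
  then have "AE \<theta> in Q. 0 \<le> (\<Prod>j<d. psd_pmf b (\<theta> j) (ks ! j))"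
    by eventually_elim (auto intro!: prod_nonneg psd_pmf_nonneg pos)
  then show ?thesis by (auto simp: mix_pmf_def intro!: integral_nonneg_AE)
qed

text \<open>Tonelli followed by factorization of the sum over lists. The weight 1 yields the total
  mass, and an indicator yields the probability of a box.\<close>

lemma nn_integral_mix_pmf_weighted:
  fixes w :: "nat \<Rightarrow> ennreal"
  shows "(\<integral>\<^sup>+ ks. ennreal (mix_pmf d b Q ks) * (\<Prod>j<d. w (ks ! j)) \<partial>count_space UNIV)
    = (\<integral>\<^sup>+ \<theta>. (\<Prod>j<d. \<integral>\<^sup>+ k. ennreal (psd_pmf b (\<theta> j) k) * w k \<partial>count_space UNIV) \<partial>Q)"
proof -
  have meas: "(\<lambda>\<theta>. psd_pmf b (\<theta> j) k) \<in> borel_measurable Q" if "j < d" for j k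
    using adm that by (intro measurable_psd_pmf_component) (auto simp: admissible_mixing_def)
  let ?G = "\<lambda>\<theta> ks. if length ks = d then \<Prod>j<d. ennreal (psd_pmf b (\<theta> j) (ks ! j)) * w (ks ! j) else 0"
  have G: "(\<lambda>\<theta>. ?G \<theta> ks) \<in> borel_measurable Q" for ks
    by (cases "length ks = d")
       (auto intro!: borel_measurable_prod_ennreal borel_measurable_times_ennreal
          measurable_compose[OF meas measurable_ennreal])
  have "(\<integral>\<^sup>+ ks. ennreal (mix_pmf d b Q ks) * (\<Prod>j<d. w (ks ! j)) \<partial>count_space UNIV)
    = (\<integral>\<^sup>+ ks. (\<integral>\<^sup>+ \<theta>. ?G \<theta> ks \<partial>Q) \<partial>count_space UNIV)"
  proof (rule nn_integral_cong)
    fix ks :: "nat list"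
    show "ennreal (mix_pmf d b Q ks) * (\<Prod>j<d. w (ks ! j)) = (\<integral>\<^sup>+ \<theta>. ?G \<theta> ks \<partial>Q)"
    proof (cases "length ks = d")
      case True
      then show ?thesis
        unfolding mix_pmf_nn_integral
        by (subst nn_integral_multc[symmetric])
           (auto intro!: nn_integral_cong borel_measurable_prod_ennreal
              measurable_compose[OF meas measurable_ennreal] simp: prod.distrib)
    qed (simp add: mix_pmf_nn_integral)
  qed
  also have "\<dots> = (\<integral>\<^sup>+ \<theta>. (\<integral>\<^sup>+ ks. ?G \<theta> ks \<partial>count_space UNIV) \<partial>Q)"
    by (rule nn_integral_count_space_nn_integral[symmetric]) (auto intro: G)
  also have "(\<lambda>\<theta>. \<integral>\<^sup>+ ks. ?G \<theta> ks \<partial>count_space UNIV)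
    = (\<lambda>\<theta>. \<Prod>j<d. \<integral>\<^sup>+ k. ennreal (psd_pmf b (\<theta> j) k) * w k \<partial>count_space UNIV)"
    by (rule ext, rule nn_integral_list_prod)
  finally show ?thesis .
qed

lemma nn_integral_mix_pmf: "(\<integral>\<^sup>+ ks. ennreal (mix_pmf d b Q ks) \<partial>count_space UNIV) = 1"
proof -
  interpret prob_space Q using adm by (simp add: admissible_mixing_def)
  have "AE \<theta> in Q. \<forall>j<d. \<theta> j \<in> psd_T b"
    using adm by (simp add: admissible_mixing_def)
  then have "AE \<theta> in Q. (\<Prod>j<d. \<integral>\<^sup>+ k. ennreal (psd_pmf b (\<theta> j) k) \<partial>count_space UNIV) = 1"
  proof eventually_elim
    case (elim \<theta>)
    have "(\<integral>\<^sup>+ k. ennreal (psd_pmf b (\<theta> j) k) \<partial>count_space UNIV) = 1" if "j < d" for j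
    proof -
      have T: "\<theta> j \<in> psd_T b" using elim that by simp
      show ?thesis
        using suminf_ennreal_eq[OF psd_pmf_nonneg[OF pos T] psd_pmf_sums[OF pos T]]
        by (simp add: nn_integral_count_space_nat)
    qed
    then show ?case by simp
  qed
  then have "(\<integral>\<^sup>+ \<theta>. (\<Prod>j<d. \<integral>\<^sup>+ k. ennreal (psd_pmf b (\<theta> j) k) \<partial>count_space UNIV) \<partial>Q) = (\<integral>\<^sup>+ \<theta>. 1 \<partial>Q)"
    by (rule nn_integral_cong_AE)
  then show ?thesis
    using nn_integral_mix_pmf_weighted[of "\<lambda>_. 1"] by (simp add: emeasure_space_1)
qed

lemma pmf_embed_mix_pmf: "pmf (embed_pmf (mix_pmf d b Q)) = mix_pmf d b Q"
  by (rule ext, rule pmf_embed_pmf) (auto simp: mix_pmf_nonneg nn_integral_mix_pmf)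

text \<open>The summation set of \<open>hell_pmf\<close> is a parameter precisely so that it can be
  matched to the lists of length \<open>d\<close> in \<open>hellinger\<close>.\<close>

lemma hell_pmf_embed_mix_pmf:
  "hell_pmf p (embed_pmf (mix_pmf d b Q)) {ks. length ks = d} = hellinger d (pmf p) (mix_pmf d b Q)"
  by (simp add: hell_pmf_def hellinger_def pmf_embed_mix_pmf)

text \<open>Given the mixing parameter, the coordinates are independent and each stays below
  \<open>m\<close> with probability at least \<open>1 - \<tau>\<close>. The resulting product bound
  survives averaging over \<open>Q\<close>.\<close>

lemma mix_pmf_box_ge:
  assumes \<tau>: "\<tau> \<le> 1" and head: "AE \<theta> in Q. \<forall>j<d. 1 - \<tau> \<le> (\<Sum>k<m. psd_pmf b (\<theta> j) k)"
  shows "(1 - \<tau>) ^ d \<le> measure_pmf.prob (embed_pmf (mix_pmf d b Q)) {ks. length ks = d \<and> (\<forall>j<d. ks ! j < m)}"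
    (is "_ \<le> measure_pmf.prob ?P ?A")
proof -
  interpret prob_space Q using adm by (simp add: admissible_mixing_def)
  let ?w = "indicator {..<m} :: nat \<Rightarrow> ennreal"
  have AE: "AE \<theta> in Q. \<forall>j<d. \<theta> j \<in> psd_T b"
    using adm by (simp add: admissible_mixing_def)
  have "ennreal ((1 - \<tau>) ^ d) = (\<integral>\<^sup>+ \<theta>. (\<Prod>j<d. ennreal (1 - \<tau>)) \<partial>Q)"
    using \<tau> by (simp add: emeasure_space_1 ennreal_power)
  also have "\<dots> \<le> (\<integral>\<^sup>+ \<theta>. (\<Prod>j<d. \<integral>\<^sup>+ k. ennreal (psd_pmf b (\<theta> j) k) * ?w k \<partial>count_space UNIV) \<partial>Q)"
  proof (rule nn_integral_mono_AE)
    show "AE \<theta> in Q. (\<Prod>j<d. ennreal (1 - \<tau>))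
      \<le> (\<Prod>j<d. \<integral>\<^sup>+ k. ennreal (psd_pmf b (\<theta> j) k) * ?w k \<partial>count_space UNIV)"
      using AE head
    proof eventually_elim
      case (elim \<theta>)
      show ?case
      proof (rule prod_mono_ennreal)
        fix j assume "j \<in> {..<d}"
        then have "j < d" by simp
        then have T: "\<theta> j \<in> psd_T b" using elim by simp
        have "ennreal (1 - \<tau>) \<le> ennreal (\<Sum>k<m. psd_pmf b (\<theta> j) k)"
          using elim(2) \<open>j < d\<close> by (intro ennreal_leI) auto
        also have "\<dots> = (\<Sum>k<m. ennreal (psd_pmf b (\<theta> j) k))"
          by (intro sum_ennreal[symmetric] psd_pmf_nonneg pos T)
        also have "\<dots> = (\<integral>\<^sup>+ k. ennreal (psd_pmf b (\<theta> j) k) * ?w k \<partial>count_space UNIV)"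
          by (subst nn_integral_count_space'[where A = "{..<m}"]) auto
        finally show "ennreal (1 - \<tau>) \<le> (\<integral>\<^sup>+ k. ennreal (psd_pmf b (\<theta> j) k) * ?w k \<partial>count_space UNIV)" .
      qed
    qed
  qed
  also have "\<dots> = (\<integral>\<^sup>+ ks. ennreal (mix_pmf d b Q ks) * (\<Prod>j<d. ?w (ks ! j)) \<partial>count_space UNIV)"
    by (rule nn_integral_mix_pmf_weighted[symmetric])
  also have "\<dots> = (\<integral>\<^sup>+ ks. ennreal (pmf ?P ks) * indicator ?A ks \<partial>count_space UNIV)"
  proof (rule nn_integral_cong)
    fix ks :: "nat list"
    have "(\<Prod>j<d. ?w (ks ! j)) = (if \<forall>j<d. ks ! j < m then 1 else 0)"
      by (auto simp: indicator_def)
    then show "ennreal (mix_pmf d b Q ks) * (\<Prod>j<d. ?w (ks ! j)) = ennreal (pmf ?P ks) * indicator ?A ks"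
      by (auto simp: pmf_embed_mix_pmf mix_pmf_def indicator_def)
  qed
  also have "\<dots> = (\<integral>\<^sup>+ ks. ennreal (pmf ?P ks) \<partial>count_space ?A)"
    by (simp add: nn_integral_count_space_indicator)
  also have "\<dots> = ennreal (measure_pmf.prob ?P ?A)"
    by (simp add: nn_integral_pmf measure_pmf.emeasure_eq_measure)
  finally show ?thesis by simp
qed

end

text \<open>From index \<open>w\<close> on, consecutive probabilities shrink by a factor of at most
  \<open>t\<close>, because \<open>\<theta> \<le> \<theta>t\<close>. Starting from a probability of
  at most 1 at \<open>w\<close>, the tail from \<open>m\<close> on is dominated by a geometric
  series.\<close>

lemma psd_pmf_head_ge:
  assumes pos: "\<And>k. 0 < b k" and \<theta>: "\<theta> \<in> psd_T b" "\<theta> \<le> \<theta>t" "0 < \<theta>t"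
    and t: "0 < t" "t < 1" and ratio: "\<And>k. k \<ge> w \<Longrightarrow> b (Suc k) / b k \<le> t / \<theta>t" and "w \<le> m"
  shows "1 - t ^ (m - w) / (1 - t) \<le> (\<Sum>k<m. psd_pmf b \<theta> k)"
proof -
  have "0 \<le> \<theta>" using \<theta> by (simp add: psd_T_def)
  have step: "psd_pmf b \<theta> (Suc k) \<le> t * psd_pmf b \<theta> k" if "k \<ge> w" for k
  proof -
    have "b (Suc k) * \<theta> \<le> t * b k"
    proof -
      have "b (Suc k) * \<theta> \<le> b (Suc k) * \<theta>t"
        using \<theta>(2) pos[of "Suc k"] by simp
      also have "\<dots> \<le> t * b k"
        using ratio[OF that] pos[of k] \<theta>(3) by (simp add: field_simps)
      finally show ?thesis .
    qed
    then have "b (Suc k) * \<theta> * \<theta> ^ k \<le> t * b k * \<theta> ^ k"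
      using \<open>0 \<le> \<theta>\<close> by (intro mult_right_mono) auto
    then show ?thesis
      using psd_sum_pos[OF pos \<theta>(1)] by (simp add: psd_pmf_def field_simps)
  qed
  have geo: "psd_pmf b \<theta> (w + i) \<le> t ^ i" for i
  proof (induction i)
    case 0
    then show ?case using psd_pmf_le_1[OF pos \<theta>(1)] by simp
  next
    case (Suc i)
    have "psd_pmf b \<theta> (w + Suc i) \<le> t * psd_pmf b \<theta> (w + i)" using step[of "w + i"] by simp
    also have "\<dots> \<le> t * t ^ i" using Suc t by simp
    finally show ?case by simp
  qed
  have s: "summable (psd_pmf b \<theta>)" "(\<Sum>k. psd_pmf b \<theta> k) = 1"
    using psd_pmf_sums[OF pos \<theta>(1)] by (auto simp: sums_iff)
  have "(\<Sum>i. psd_pmf b \<theta> (i + m)) \<le> (\<Sum>i. t ^ (m - w) * t ^ i)"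
  proof (rule suminf_le)
    show "psd_pmf b \<theta> (i + m) \<le> t ^ (m - w) * t ^ i" for i
    proof -
      have "w + (m - w + i) = i + m" using \<open>w \<le> m\<close> by simp
      from geo[of "m - w + i", unfolded this] show ?thesis by (simp only: power_add)
    qed
    show "summable (\<lambda>i. psd_pmf b \<theta> (i + m))" using s(1) by (simp add: summable_iff_shift)
    show "summable (\<lambda>i. t ^ (m - w) * t ^ i)" using t by (intro summable_mult summable_geometric) auto
  qed
  also have "\<dots> = t ^ (m - w) / (1 - t)"
    using t by (subst suminf_mult) (auto simp: suminf_geometric summable_geometric)
  finally show ?thesis
    using suminf_split_initial_segment[OF s(1), of m] s(2) by simp
qed

text \<open>A nonzero limit of the coefficient ratios is the reciprocal of the radius of
  convergence; a zero limit lies below any positive number.\<close>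

lemma ratio_limit_less:
  fixes b :: "nat \<Rightarrow> real"
  assumes pos: "\<And>k. 0 < b k" and lim: "(\<lambda>k. b (Suc k) / b k) \<longlonglongrightarrow> l"
    and \<theta>: "0 < \<theta>" "0 < t" "ereal (\<theta> / t) < conv_radius b"
  shows "l < t / \<theta>"
proof (cases "l = 0")
  case False
  have "(\<lambda>k. inverse (b (Suc k) / b k)) \<longlonglongrightarrow> inverse l"
    by (intro tendsto_inverse lim False)
  then have "(\<lambda>k. norm (b k) / norm (b (Suc k))) \<longlonglongrightarrow> inverse l"
    using pos by (simp add: abs_of_pos)
  then have "conv_radius b = ereal (inverse l)"
    using False by (intro conv_radius_ratio_limit_nonzero[of _ "inverse l"]) auto
  then have less: "\<theta> / t < inverse l" using \<theta> by simp
  have "0 \<le> l"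
    by (rule LIMSEQ_le_const[OF lim]) (auto intro!: less_imp_le pos divide_pos_pos)
  then have "0 < l" using False by simp
  then show ?thesis using less \<theta> by (simp add: field_simps)
qed (use \<theta> in simp)

text \<open>The strict inequality for the limit supplies a witness for the least element in
  \<open>W_const\<close>, which therefore has its defining property.\<close>

lemma W_const_ratio:
  fixes b :: "nat \<Rightarrow> real"
  assumes "\<And>k. 0 < b k" "(\<lambda>k. b (Suc k) / b k) \<longlonglongrightarrow> l" "0 < \<theta>" "0 < t" "ereal (\<theta> / t) < conv_radius b"
  shows "3 \<le> W_const b t \<theta>" and "k \<ge> W_const b t \<theta> \<Longrightarrow> b (Suc k) / b k \<le> t / \<theta>"
proof -
  have "eventually (\<lambda>k. b (Suc k) / b k < t / \<theta>) sequentially"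
    by (rule order_tendstoD(2)[OF assms(2)]) (rule ratio_limit_less[OF assms])
  then obtain w where "\<And>k. k \<ge> w \<Longrightarrow> b (Suc k) / b k < t / \<theta>"
    by (auto simp: eventually_sequentially)
  then have "3 \<le> max 3 w \<and> (\<forall>k\<ge>max 3 w. b (Suc k) / b k \<le> t / \<theta>)"
    by (auto intro: less_imp_le)
  then have "3 \<le> W_const b t \<theta> \<and> (\<forall>k\<ge>W_const b t \<theta>. b (Suc k) / b k \<le> t / \<theta>)"
    unfolding W_const_def by (rule LeastI)
  then show "3 \<le> W_const b t \<theta>" and "k \<ge> W_const b t \<theta> \<Longrightarrow> b (Suc k) / b k \<le> t / \<theta>"
    by auto
qed

text \<open>This lets the constant of the geometric tail be replaced by the factor
  \<open>n\<close>.\<close>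

lemma N_const_ge: "1 / (t0 ^ (W_const b t0 \<theta>t - 1) * (1 - t0)) \<le> N_const d b t0 \<theta>t \<delta>0 \<eta>0 V"
proof -
  have "x \<le> of_int \<lfloor>max y x\<rfloor> + 1" for x y :: real
    by linarith
  then show ?thesis by (simp add: N_const_def Let_def)
qed

section \<open>Consequences of the model assumptions\<close>

context
  fixes d :: nat and b Q0 q0 M \<delta>0 \<eta>0 V t0 \<theta>t
  assumes asm: "psd_assumptions d b Q0 q0 M \<delta>0 \<eta>0 V"
  defines "t0 \<equiv> t0_const b q0" and "\<theta>t \<equiv> theta_tilde b q0 M"
begin

lemma
  shows psd_d_ge_1: "1 \<le> d" and psd_coeff_pos: "\<And>k. 0 < b k" and psd_admissible: "admissible_mixing d b Q0"
  using asm by (auto simp: psd_assumptions_def)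

text \<open>For a finite radius, \<open>t0\<close> is the midpoint of \<open>q0\<close> and 1. Since
  \<open>q0 < t0\<close>, dividing \<open>\<theta>t\<close> by \<open>t0\<close> still stays inside
  the radius.\<close>

lemma
  shows t0_ge_half: "1 / 2 \<le> t0" and t0_less_1: "t0 < 1" and theta_tilde_pos: "0 < \<theta>t"
    and theta_tilde_less_radius: "ereal (\<theta>t / t0) < conv_radius b"
proof -
  have R: "0 < conv_radius b" using asm by (simp add: psd_assumptions_def)
  have "1 / 2 \<le> t0 \<and> t0 < 1 \<and> 0 < \<theta>t \<and> ereal (\<theta>t / t0) < conv_radius b"
  proof (cases "conv_radius b = \<infinity>")
    case True
    then show ?thesis
      using asm by (simp add: psd_assumptions_def t0_def \<theta>t_def t0_const_def theta_tilde_def)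
  next
    case False
    then obtain r where r: "conv_radius b = ereal r" "0 < r"
      using R by (cases "conv_radius b") auto
    then have q: "0 < q0" "q0 < 1"
      using asm by (auto simp: psd_assumptions_def)
    have "q0 * r / ((q0 + 1) / 2) < r"
      using q r by (simp add: field_simps)
    then show ?thesis
      using q r by (simp add: t0_def \<theta>t_def t0_const_def theta_tilde_def)
  qed
  then show "1 / 2 \<le> t0" "t0 < 1" "0 < \<theta>t" "ereal (\<theta>t / t0) < conv_radius b"
    by auto
qed

lemma AE_psd_T: "AE \<theta> in Q0. \<forall>j<d. \<theta> j \<in> psd_T b \<and> \<theta> j \<le> \<theta>t"
proof -
  interpret prob_space Q0 using psd_admissible by (simp add: admissible_mixing_def)
  define E where "E = {\<theta> \<in> space Q0. \<not> (\<forall>j<d. \<theta> j \<in> {0..\<theta>t})}"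
  have sets: "sets Q0 = sets (param_space d)"
    using psd_admissible by (simp add: admissible_mixing_def)
  have "measure Q0 E = 0"
    unfolding E_def using asm by (auto simp: psd_assumptions_def \<theta>t_def theta_tilde_def split: if_splits)
  \<comment> \<open>\<open>measure\<close> is also 0 on nonmeasurable sets, so measurability is
    required before \<open>E\<close> can be called a null set.\<close>
  moreover have "E \<in> sets Q0"
  proof -
    have [measurable]: "(\<lambda>\<theta>. \<theta> j) \<in> borel_measurable Q0" if "j < d" for j
      using measurable_param_component[OF sets that] .
    have "E = (\<Union>j<d. {\<theta> \<in> space Q0. \<theta> j \<notin> {0..\<theta>t}})" by (auto simp: E_def)
    also have "\<dots> \<in> sets Q0"
      by (intro sets.finite_UN) (auto intro!: measurable_sets_Collect)
    finally show ?thesis .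
  qed
  ultimately have "E \<in> null_sets Q0"
    by (intro null_setsI) (simp_all add: emeasure_eq_measure)
  then have "AE \<theta> in Q0. \<theta> \<notin> E"
    by (rule AE_not_in)
  moreover have "AE \<theta> in Q0. \<forall>j<d. \<theta> j \<in> psd_T b"
    using psd_admissible by (simp add: admissible_mixing_def)
  ultimately show ?thesis
    using AE_space by eventually_elim (auto simp: E_def)
qed

text \<open>Each coordinate exceeds the box with probability at most \<open>\<tau>\<close>, which is
  at most \<open>n * t0 ^ (m - 1)\<close> by the lower bound on \<open>n\<close>; Bernoulli's
  inequality collects the \<open>d\<close> coordinates.\<close>

lemma mix_pmf_box_tail:
  assumes n: "real n \<ge> N_const d b t0 \<theta>t \<delta>0 \<eta>0 V"
  shows "measure_pmf.prob (embed_pmf (mix_pmf d b Q0)) (- {ks. length ks = d \<and> (\<forall>j<d. ks ! j < m)})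
    \<le> real d * real n * t0 ^ (m - 1)"
    (is "measure_pmf.prob ?P (- ?A) \<le> ?r")
proof -
  define w where "w = W_const b t0 \<theta>t"
  define \<tau> where "\<tau> = t0 ^ (m - w) / (1 - t0)"
  have t0: "0 < t0" "t0 < 1" using t0_ge_half t0_less_1 by auto
  obtain l where l: "(\<lambda>k. b (Suc k) / b k) \<longlonglongrightarrow> l"
    using asm by (auto simp: psd_assumptions_def)
  note W = W_const_ratio[OF psd_coeff_pos l theta_tilde_pos t0(1) theta_tilde_less_radius, folded w_def]
  have nw: "1 / (t0 ^ (w - 1) * (1 - t0)) \<le> real n"
    using N_const_ge[of t0 b \<theta>t] n unfolding w_def by (rule order_trans)
  show ?thesis
  proof (cases "w \<le> m \<and> \<tau> \<le> 1")
    case True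
    have \<tau>: "\<tau> = t0 ^ (m - 1) * (1 / (t0 ^ (w - 1) * (1 - t0)))"
    proof -
      have "m - 1 = (m - w) + (w - 1)" using True W(1) by simp
      then have "t0 ^ (m - 1) = t0 ^ (m - w) * t0 ^ (w - 1)" by (simp only: power_add)
      then show ?thesis using t0 by (simp add: \<tau>_def)
    qed
    also have "\<dots> \<le> t0 ^ (m - 1) * real n"
      using t0 by (intro mult_left_mono nw) auto
    finally have "real d * \<tau> \<le> real d * (t0 ^ (m - 1) * real n)"
      by (rule mult_left_mono) simp
    then have "real d * \<tau> \<le> ?r" by (simp only: ac_simps)
    have "1 - real d * \<tau> \<le> (1 - \<tau>) ^ d"
      using Bernoulli_inequality[of "- \<tau>" d] True by simp
    also have "\<dots> \<le> measure_pmf.prob ?P ?A"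
    proof (rule mix_pmf_box_ge[OF psd_coeff_pos psd_admissible])
      show "AE \<theta> in Q0. \<forall>j<d. 1 - \<tau> \<le> (\<Sum>k<m. psd_pmf b (\<theta> j) k)"
        using AE_psd_T
      proof eventually_elim
        case (elim \<theta>)
        then show ?case
          unfolding \<tau>_def using True W(2) t0 theta_tilde_pos
          by (auto intro!: psd_pmf_head_ge[where \<theta>t = \<theta>t] psd_coeff_pos)
      qed
    qed (use True in simp)
    finally show ?thesis
      using measure_pmf.prob_compl[of ?A ?P] \<open>real d * \<tau> \<le> ?r\<close> by (simp add: Compl_eq_Diff_UNIV)
  next
    case False
    \<comment> \<open>For \<open>m\<close> below \<open>w\<close> or \<open>\<tau>\<close> above 1
      the claimed bound is at least 1, hence trivial for a probability. This includes
      \<open>m = 0\<close>, where \<open>m - 1\<close> is truncated to 0.\<close>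
    have "1 \<le> t0 ^ (m - 1) * (1 / (t0 ^ (w - 1) * (1 - t0)))"
    proof (cases "w \<le> m")
      case True
      have "m - 1 = (m - w) + (w - 1)" using True W(1) by simp
      then have "t0 ^ (m - 1) = t0 ^ (m - w) * t0 ^ (w - 1)" by (simp only: power_add)
      then show ?thesis using t0 True False by (simp add: \<tau>_def)
    next
      case False
      then have "t0 ^ (w - 1) \<le> t0 ^ (m - 1)" using t0 by (intro power_decreasing) auto
      moreover have "t0 ^ (w - 1) * (1 - t0) \<le> t0 ^ (w - 1) * 1"
        using t0 by (intro mult_left_mono) auto
      ultimately have "t0 ^ (w - 1) * (1 - t0) \<le> t0 ^ (m - 1)" by linarith
      then show ?thesis using t0 by simp
    qed
    also have "\<dots> \<le> t0 ^ (m - 1) * real n"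
      using t0 by (intro mult_left_mono nw) auto
    also have "\<dots> \<le> ?r"
      using psd_d_ge_1 t0 mult_right_mono[of 1 "real d" "t0 ^ (m - 1) * real n"] by (simp add: ac_simps)
    finally show ?thesis
      using measure_pmf.prob_le_1[of ?P "- ?A"] by linarith
  qed
qed

text \<open>As \<open>w \<ge> 3\<close>, the denominator in \<open>N_const_ge\<close> is at most
  \<open>t0 * (1 - t0)\<close>, and that product never exceeds 1/4.\<close>

lemma n_ge_4:
  assumes n: "real n \<ge> N_const d b t0 \<theta>t \<delta>0 \<eta>0 V"
  shows "4 \<le> n"
proof -
  define w where "w = W_const b t0 \<theta>t"
  have t0: "0 < t0" "t0 < 1" using t0_ge_half t0_less_1 by auto
  obtain l where l: "(\<lambda>k. b (Suc k) / b k) \<longlonglongrightarrow> l"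
    using asm by (auto simp: psd_assumptions_def)
  have "3 \<le> w"
    unfolding w_def using W_const_ratio[OF psd_coeff_pos l theta_tilde_pos t0(1) theta_tilde_less_radius] by simp
  have "t0 ^ (w - 1) * (1 - t0) \<le> t0 ^ 1 * (1 - t0)"
    using t0 \<open>3 \<le> w\<close> by (intro mult_right_mono power_decreasing) auto
  also have "\<dots> \<le> 1 / 4"
    using zero_le_power2[of "t0 - 1 / 2"] by (simp add: power2_eq_square algebra_simps)
  finally have "4 \<le> 1 / (t0 ^ (w - 1) * (1 - t0))"
    using t0 by (simp add: field_simps)
  then have "4 \<le> real n"
    using N_const_ge[of t0 b \<theta>t d \<delta>0 \<eta>0 V] n unfolding w_def by linarith
  then show ?thesis by simp
qed

lemma npmle_hellinger_deviation:
  assumes n: "real n \<ge> N_const d b t0 \<theta>t \<delta>0 \<eta>0 V" and "s > 0"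
    and tail: "4 * (real d * real n * t0 ^ (m - 1)) \<le> s\<^sup>2"
    and mle: "\<forall>X\<in>set_pmf (sample_pmf d b Q0 n). is_npmle d b n X (Qh X)"
  shows "measure_pmf.prob (sample_pmf d b Q0 n) {X. hellinger d (mix_pmf d b (Qh X)) (mix_pmf d b Q0) > s}
    \<le> real n * (real d * real n * t0 ^ (m - 1)) + 4 * real m ^ d / (real n * s\<^sup>2)"
proof -
  let ?P = "embed_pmf (mix_pmf d b Q0)" and ?A = "{ks. length ks = d \<and> (\<forall>j<d. ks ! j < m)}"
  let ?Ph = "\<lambda>X. embed_pmf (mix_pmf d b (Qh X))"
  let ?M = "sample_pmf d b Q0 n"
  \<comment> \<open>Intersecting the box with the support makes all true probabilities on
    \<open>B\<close> positive without changing its mass.\<close>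
  define B where "B = ?A \<inter> set_pmf ?P"
  note emb0 = pmf_embed_mix_pmf[OF psd_coeff_pos psd_admissible]
  have adm: "admissible_mixing d b (Qh X)" if "X \<in> set_pmf ?M" for X
    using mle that by (auto simp: is_npmle_def)
  have "n > 0" using n_ge_4[OF n] by simp
  have A: "?A \<subseteq> {ks. set ks \<subseteq> {..<m} \<and> length ks = d}"
    by (auto simp: in_set_conv_nth)
  then have "finite ?A"
    by (rule finite_subset) (simp add: finite_lists_length_eq)
  then have "finite B" by (simp add: B_def)
  have "card B \<le> card {ks. set ks \<subseteq> {..<m} \<and> length ks = d}"
    using A by (intro card_mono) (auto simp: B_def finite_lists_length_eq)
  then have card: "card B \<le> m ^ d" by (simp add: card_lists_length_eq)
  have "measure_pmf.prob ?P (- B) = 1 - measure_pmf.prob ?P ?A"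
    using measure_pmf.prob_compl[of B ?P]
    by (simp add: Compl_eq_Diff_UNIV B_def measure_Int_set_pmf)
  also have "\<dots> = measure_pmf.prob ?P (- ?A)"
    using measure_pmf.prob_compl[of ?A ?P] by (simp add: Compl_eq_Diff_UNIV)
  also have "\<dots> \<le> real d * real n * t0 ^ (m - 1)"
    by (rule mix_pmf_box_tail[OF n])
  finally have PB: "measure_pmf.prob ?P (- B) \<le> real d * real n * t0 ^ (m - 1)" .
  have "measure_pmf.prob ?M {X. hellinger d (mix_pmf d b (Qh X)) (mix_pmf d b Q0) > s}
    = measure_pmf.prob ?M {X. hell_pmf (?Ph X) ?P {ks. length ks = d} > s}"
  \<comment> \<open>The fitted mixture is known to be admissible only for samples in the support, so
    the two events are compared almost everywhere.\<close>
  proof (rule measure_pmf.finite_measure_eq_AE)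
    show "AE X in ?M. X \<in> {X. hellinger d (mix_pmf d b (Qh X)) (mix_pmf d b Q0) > s}
      \<longleftrightarrow> X \<in> {X. hell_pmf (?Ph X) ?P {ks. length ks = d} > s}"
    proof (rule AE_pmfI)
      fix X assume "X \<in> set_pmf ?M"
      then have "pmf (?Ph X) = mix_pmf d b (Qh X)"
        by (intro pmf_embed_mix_pmf psd_coeff_pos adm)
      then show "X \<in> {X. hellinger d (mix_pmf d b (Qh X)) (mix_pmf d b Q0) > s}
        \<longleftrightarrow> X \<in> {X. hell_pmf (?Ph X) ?P {ks. length ks = d} > s}"
        by (simp add: hell_pmf_embed_mix_pmf[OF psd_coeff_pos psd_admissible])
    qed
  qed auto
  also have "\<dots> \<le> real n * measure_pmf.prob ?P (- B) + 4 * real (card B) / (real n * s\<^sup>2)"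
    unfolding sample_pmf_def
  proof (rule mle_hellinger_deviation)
    show "B \<subseteq> set_pmf ?P" "B \<subseteq> {ks. length ks = d}" by (auto simp: B_def)
    show "4 * measure_pmf.prob ?P (- B) \<le> s\<^sup>2" using PB tail by linarith
    fix X assume "X \<in> set_pmf (Pi_pmf {..<n} [] (\<lambda>_. ?P))"
    then have X: "X \<in> set_pmf ?M" by (simp add: sample_pmf_def)
    then have "likelihood d b n X Q0 \<le> likelihood d b n X (Qh X)"
      using mle psd_admissible by (auto simp: is_npmle_def)
    then show "(\<Prod>i<n. pmf ?P (X i)) \<le> (\<Prod>i<n. pmf (?Ph X) (X i))"
      by (simp add: likelihood_def emb0 pmf_embed_mix_pmf[OF psd_coeff_pos adm[OF X]])
  qed fact+
  also have "\<dots> \<le> real n * (real d * real n * t0 ^ (m - 1)) + 4 * real m ^ d / (real n * s\<^sup>2)"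
  proof (intro add_mono mult_left_mono divide_right_mono PB)
    show "real (card B) \<le> real m ^ d" using card by (metis of_nat_le_iff of_nat_power)
  qed auto
  finally show ?thesis .
qed

end

subsection \<open>The convergence rate\<close>

text \<open>With \<open>exp y = n * d\<close>, the factor 5/2 makes
  \<open>n * (d * n * t0 ^ (m - 1))\<close> at most \<open>exp (2 * y - 5 / 2 * y)\<close>, hence at
  most \<open>1 / sqrt n\<close>. The added 1 compensates for the exponent
  \<open>m - 1\<close>.\<close>

lemma truncation_level_bounds:
  fixes y \<kappa> :: real
  assumes "4 \<le> y" "0 < \<kappa>" "\<kappa> \<le> 1"
  defines "m \<equiv> nat \<lceil>5 / 2 * y / \<kappa>\<rceil> + 1"
  shows "real m \<le> 3 * y / \<kappa>" and "exp (- \<kappa>) ^ (m - 1) \<le> exp (- (5 / 2 * y))"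
proof -
  let ?x = "5 / 2 * y / \<kappa>"
  have x: "0 \<le> ?x" using assms by simp
  have m: "real m = of_int \<lceil>?x\<rceil> + 1"
    using x unfolding m_def by (simp add: ceiling_le_iff)
  \<comment> \<open>Ceiling and added 1 cost at most 2, which fits into the gap between 5/2 and 3
    times \<open>y / \<kappa>\<close>.\<close>
  have "4 \<le> y / \<kappa>" using assms by (simp add: field_simps)
  then have "?x + 2 \<le> 3 * y / \<kappa>" by (simp add: field_simps)
  then show "real m \<le> 3 * y / \<kappa>" unfolding m using of_int_ceiling_le_add_one[of ?x] by linarith
  have "5 / 2 * y \<le> real (m - 1) * \<kappa>"
  proof -
    have "?x \<le> real (m - 1)" using m le_of_int_ceiling[of ?x] by (simp add: m_def)
    then show ?thesis using assms(2) by (simp only: pos_divide_le_eq)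
  qed
  then show "exp (- \<kappa>) ^ (m - 1) \<le> exp (- (5 / 2 * y))"
    by (simp add: exp_of_nat_mult[symmetric])
qed

lemma ln_4_ge_1: "1 \<le> ln (4 :: real)"
proof -
  have "exp 1 \<le> (4 :: real)" using exp_le by simp
  then show ?thesis by (metis exp_gt_zero exp_le_cancel_iff exp_ln less_le_trans)
qed

text \<open>The number 64 is the sample size forced by \<open>8 \<le> L\<close> and
  \<open>L < sqrt n\<close>.\<close>

lemma four_le_ln:
  fixes x :: real
  assumes "64 \<le> x"
  shows "4 \<le> ln x"
proof -
  have "exp (4 :: real) = exp 1 ^ 4" by (simp flip: exp_of_nat_mult)
  also have "\<dots> \<le> (11 / 4) ^ 4"
    using e_less_272 by (intro power_mono) auto
  also have "\<dots> \<le> x" using assms by (simp add: power_divide)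
  finally show ?thesis using assms by (simp add: ln_ge_iff)
qed

section \<open>Deviation bounds at the convergence rate\<close>

context
  fixes d :: nat and b Q0 q0 M \<delta>0 \<eta>0 V t0 \<theta>t
  assumes asm: "psd_assumptions d b Q0 q0 M \<delta>0 \<eta>0 V"
  defines "t0 \<equiv> t0_const b q0" and "\<theta>t \<equiv> theta_tilde b q0 M"
begin

lemma ln_nd_ge_1:
  assumes n: "real n \<ge> N_const d b t0 \<theta>t \<delta>0 \<eta>0 V"
  shows "1 \<le> ln (real n * real d)"
proof -
  have "4 \<le> real n" using n_ge_4[OF asm] n unfolding t0_def \<theta>t_def by simp
  then have "4 * 1 \<le> real n * real d"
    using psd_d_ge_1[OF asm] by (intro mult_mono) auto
  then have "ln 4 \<le> ln (real n * real d)" by simp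
  then show ?thesis using ln_4_ge_1 by linarith
qed

text \<open>The regime in which the threshold is informative. The first summand bounds the
  probability of leaving the box, the second comes from Markov's inequality for Pearson's
  statistic.\<close>

lemma npmle_rate_large:
  fixes L :: real
  defines "\<kappa> \<equiv> ln (1 / t0)"
  assumes n: "real n \<ge> N_const d b t0 \<theta>t \<delta>0 \<eta>0 V" and L: "8 \<le> L"
    and small: "L * ln (real n * real d) powr (1 + real d / 2) / sqrt (real n) < 1"
    and mle: "\<forall>X\<in>set_pmf (sample_pmf d b Q0 n). is_npmle d b n X (Qh X)"
  shows "measure_pmf.prob (sample_pmf d b Q0 n)
      {X. hellinger d (mix_pmf d b (Qh X)) (mix_pmf d b Q0)
        > L * ln (real n * real d) powr (1 + real d / 2) / sqrt (real n)}
    \<le> 1 / L + 3 ^ d / (\<kappa> ^ d * L)"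
proof -
  define y where "y = ln (real n * real d)"
  define s where "s = L * y powr (1 + real d / 2) / sqrt (real n)"
  have t0: "1 / 2 \<le> t0" "t0 < 1"
    using t0_ge_half[OF asm] t0_less_1[OF asm] by (auto simp: t0_def)
  have d: "1 \<le> real d" using psd_d_ge_1[OF asm] by simp
  have n4: "4 \<le> real n" using n_ge_4[OF asm] n unfolding t0_def \<theta>t_def by simp
  have y1: "1 \<le> y" unfolding y_def by (rule ln_nd_ge_1[OF n])
  have pow1: "1 \<le> y powr a" if "0 \<le> a" for a
    using y1 that by (rule ge_one_powr_ge_zero)
  \<comment> \<open>The logarithmic factor is at least 1, so a threshold below 1 forces
    \<open>L < sqrt n\<close>.\<close>
  have "L * 1 \<le> L * y powr (1 + real d / 2)"
    using L pow1 by (intro mult_left_mono) auto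
  also have "\<dots> < sqrt (real n)"
    using small n4 unfolding y_def by (simp add: field_simps)
  finally have Ln: "L < sqrt (real n)" by simp
  have nd: "real n \<le> real n * real d"
    using d n4 mult_left_mono[of 1 "real d" "real n"] by simp
  have "64 \<le> real n"
  proof -
    have "8 \<le> sqrt (real n)" using L Ln by simp
    then have "8 ^ 2 \<le> (sqrt (real n)) ^ 2" by (rule power_mono) simp
    then show ?thesis by simp
  qed
  then have y4: "4 \<le> y" unfolding y_def using nd by (intro four_le_ln) linarith
  have expy: "exp y = real n * real d"
    unfolding y_def using nd n4 by (intro exp_ln) linarith
  have \<kappa>: "0 < \<kappa>" "\<kappa> \<le> 1" "exp (- \<kappa>) = t0"
  proof -
    show "0 < \<kappa>" unfolding \<kappa>_def using t0 by simp
    have "\<kappa> \<le> 1 / t0 - 1" unfolding \<kappa>_def using t0 by (intro ln_le_minus_one) auto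
    also have "\<dots> \<le> 1" using t0 by (simp add: field_simps)
    finally show "\<kappa> \<le> 1" .
    show "exp (- \<kappa>) = t0" unfolding \<kappa>_def using t0 by (simp add: ln_div)
  qed
  define m where "m = nat \<lceil>5 / 2 * y / \<kappa>\<rceil> + 1"
  note m = truncation_level_bounds[OF y4 \<kappa>(1,2), folded m_def, unfolded \<kappa>(3)]
  have "real d * real n * t0 ^ (m - 1) \<le> exp y * exp (- (5 / 2 * y))"
    unfolding expy using m(2) by (simp add: mult_left_mono ac_simps)
  also have "\<dots> = exp (- (3 / 2 * y))" by (simp flip: exp_add)
  finally have r: "real d * real n * t0 ^ (m - 1) \<le> exp (- (3 / 2 * y))" .
  have r0: "0 \<le> real d * real n * t0 ^ (m - 1)"
    using t0 by (intro mult_nonneg_nonneg zero_le_power) auto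
  have s_pos: "s > 0"
    unfolding s_def using L y4 n4 by (intro divide_pos_pos mult_pos_pos) auto
  \<comment> \<open>The exponent in the rate pays for the box: \<open>y ^ d\<close> cancels the
    growth of \<open>m ^ d\<close>, and \<open>y\<^sup>2\<close> is left over.\<close>
  have s2: "real n * s\<^sup>2 = L\<^sup>2 * y ^ (2 + d)"
  proof -
    have "(y powr (1 + real d / 2))\<^sup>2 = y powr (real (2 + d))"
      by (simp add: power2_eq_square flip: powr_add)
    also have "\<dots> = y ^ (2 + d)" using y4 by (simp only: powr_realpow)
    finally show ?thesis
      unfolding s_def using n4 by (simp add: power_divide power_mult_distrib)
  qed
  have tail: "4 * (real d * real n * t0 ^ (m - 1)) \<le> s\<^sup>2"
  proof -
    have "real n * (4 * (real d * real n * t0 ^ (m - 1))) \<le> exp y * (4 * exp (- (3 / 2 * y)))"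
      unfolding expy using nd r0 by (intro mult_mono mult_left_mono r) auto
    also have "\<dots> = 4 * exp (- (1 / 2 * y))" by (simp flip: exp_add)
    also have "\<dots> \<le> 4" using y4 by simp
    also have "\<dots> \<le> 8 ^ 2 * 1" by simp
    also have "\<dots> \<le> L\<^sup>2 * y ^ (2 + d)"
      using L y1 by (intro mult_mono power_mono one_le_power) auto
    finally have "real n * (4 * (real d * real n * t0 ^ (m - 1))) \<le> real n * s\<^sup>2"
      by (simp only: s2)
    then show ?thesis using n4 by simp
  qed
  have "measure_pmf.prob (sample_pmf d b Q0 n) {X. hellinger d (mix_pmf d b (Qh X)) (mix_pmf d b Q0) > s}
    \<le> real n * (real d * real n * t0 ^ (m - 1)) + 4 * real m ^ d / (real n * s\<^sup>2)"
    unfolding t0_def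
    by (rule npmle_hellinger_deviation[OF asm n[unfolded t0_def \<theta>t_def] s_pos tail[unfolded t0_def] mle])
  \<comment> \<open>The escape probability is at most \<open>exp (- y / 2)\<close>, and
    \<open>exp (y / 2) \<ge> sqrt n > L\<close>.\<close>
  also have "real n * (real d * real n * t0 ^ (m - 1)) \<le> 1 / L"
  proof -
    have "(exp (1 / 2 * y))\<^sup>2 = exp y" by (simp add: power2_eq_square flip: exp_add)
    then have "exp (1 / 2 * y) = sqrt (exp y)" by (simp add: real_sqrt_unique)
    also have "\<dots> \<ge> sqrt (real n)" unfolding expy using nd by simp
    finally have "L \<le> exp (1 / 2 * y)" using Ln by linarith
    have "real n * (real d * real n * t0 ^ (m - 1)) \<le> exp y * exp (- (3 / 2 * y))"
      unfolding expy using nd r0 by (intro mult_mono r) auto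
    also have "\<dots> = inverse (exp (1 / 2 * y))" by (simp flip: exp_add exp_minus)
    also have "\<dots> \<le> inverse L"
      using L \<open>L \<le> exp (1 / 2 * y)\<close> by (intro le_imp_inverse_le) auto
    finally show ?thesis by (simp add: inverse_eq_divide)
  qed
  also have "4 * real m ^ d / (real n * s\<^sup>2) \<le> 3 ^ d / (\<kappa> ^ d * L)"
  proof -
    have "4 * real m ^ d / (real n * s\<^sup>2) \<le> 4 * (3 * y / \<kappa>) ^ d / (real n * s\<^sup>2)"
      using m(1) by (intro divide_right_mono mult_left_mono power_mono) auto
    \<comment> \<open>The spare factor \<open>4 / (L * y\<^sup>2)\<close> is at most 1 because
      \<open>L \<ge> 8\<close> and \<open>y \<ge> 1\<close>.\<close>
    also have "\<dots> = (3 ^ d / (\<kappa> ^ d * L)) * (4 / (L * y\<^sup>2))"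
      unfolding s2 using L y4 \<kappa> by (simp add: power_divide power_mult_distrib power_add power2_eq_square ac_simps)
    also have "\<dots> \<le> (3 ^ d / (\<kappa> ^ d * L)) * 1"
    proof (rule mult_left_mono)
      have "8 * 1\<^sup>2 \<le> L * y\<^sup>2" using L y1 by (intro mult_mono power_mono) auto
      then show "4 / (L * y\<^sup>2) \<le> 1" by simp
      show "0 \<le> 3 ^ d / (\<kappa> ^ d * L)" using \<kappa> L by simp
    qed
    finally show ?thesis by simp
  qed
  finally show ?thesis unfolding s_def y_def by simp
qed

text \<open>Three regimes: for \<open>L \<le> 8\<close> the right side is at least 1; for a
  threshold of at least 1 the event is null; otherwise \<open>npmle_rate_large\<close> applies.
  Since \<open>t0 \<ge> 1 / 2\<close> gives \<open>\<kappa> \<le> 1\<close>, all negative powers of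
  \<open>\<kappa>\<close> are at least 1.\<close>

lemma npmle_rate:
  fixes L :: real
  defines "\<kappa> \<equiv> ln (1 / t0)"
  assumes n: "real n \<ge> N_const d b t0 \<theta>t \<delta>0 \<eta>0 V" and L: "2 < L"
    and mle: "\<forall>X\<in>set_pmf (sample_pmf d b Q0 n). is_npmle d b n X (Qh X)"
  shows "measure_pmf.prob (sample_pmf d b Q0 n)
      {X. hellinger d (mix_pmf d b (Qh X)) (mix_pmf d b Q0)
        > L * ln (real n * real d) powr (1 + real d / 2) / sqrt (real n)}
    \<le> 8 / L * (real d * 3 ^ d / \<kappa> powr (1 + real d / 2)) * (1 + 1 / \<kappa> powr (1 + real d / 2))"
    (is "?p \<le> _")
proof -
  define A where "A = 1 / \<kappa> powr (1 + real d / 2)"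
  have t0: "1 / 2 \<le> t0" "t0 < 1"
    using t0_ge_half[OF asm] t0_less_1[OF asm] by (auto simp: t0_def)
  have d: "1 \<le> real d" using psd_d_ge_1[OF asm] by simp
  have "0 < \<kappa>" unfolding \<kappa>_def using t0 by simp
  have "\<kappa> \<le> 1 / t0 - 1" unfolding \<kappa>_def using t0 by (intro ln_le_minus_one) auto
  also have "\<dots> \<le> 1" using t0 by (simp add: field_simps)
  finally have "\<kappa> \<le> 1" .
  have A: "1 \<le> A"
    unfolding A_def using \<open>0 < \<kappa>\<close> \<open>\<kappa> \<le> 1\<close> powr_le1[of "1 + real d / 2" \<kappa>] by simp
  have A2: "1 / \<kappa> ^ d \<le> A * A"
  proof -
    have "A * A = 1 / \<kappa> ^ (2 + d)"
      using \<open>0 < \<kappa>\<close> powr_realpow[of \<kappa> "2 + d"] by (simp add: A_def flip: powr_add)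
    moreover have "\<kappa> ^ (2 + d) \<le> \<kappa> ^ d"
      using \<open>0 < \<kappa>\<close> \<open>\<kappa> \<le> 1\<close> by (intro power_decreasing) auto
    ultimately show ?thesis using \<open>0 < \<kappa>\<close> by (simp add: divide_left_mono)
  qed
  let ?r = "8 / L * (real d * 3 ^ d * A) * (1 + A)"
  have d3: "1 \<le> real d * 3 ^ d"
    using d mult_mono[of 1 "real d" 1 "3 ^ d :: real"] by simp
  have AA: "1 \<le> A * A" using A mult_mono[of 1 A 1 A] by simp
  have "?p \<le> ?r"
  proof (cases "L \<le> 8")
    case True
    have "?p \<le> 1 * 1 * 1" by simp
    also have "\<dots> \<le> 8 / L * (real d * 3 ^ d * A) * (1 + A)"
      using True L A d3 mult_mono[OF d3 A] by (intro mult_mono) (auto simp: field_simps)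
    finally show ?thesis .
  next
    case False
    show ?thesis
    proof (cases "L * ln (real n * real d) powr (1 + real d / 2) / sqrt (real n) < 1")
      case True
      have "?p \<le> 1 / L + 3 ^ d / (\<kappa> ^ d * L)"
        unfolding \<kappa>_def using npmle_rate_large[OF n _ True mle] False by simp
      also have "\<dots> = 1 / L * (1 + 3 ^ d * (1 / \<kappa> ^ d))"
        using L \<open>0 < \<kappa>\<close> by (simp add: field_simps)
      \<comment> \<open>Both summands are dominated by the same \<open>3 ^ d * A\<^sup>2\<close>;
        the resulting factor 2 is within the constant 8.\<close>
      also have "\<dots> \<le> 1 / L * (3 ^ d * (A * A) + 3 ^ d * (A * A))"
        using L A2 AA mult_mono[of 1 "3 ^ d :: real" 1 "A * A"]
        by (intro mult_left_mono add_mono) auto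
      also have "\<dots> = 2 / L * (1 * 3 ^ d * A) * A" by simp
      also have "\<dots> \<le> ?r"
        using L A d by (intro mult_mono divide_right_mono) auto
      finally show ?thesis .
    next
      case False
      have "hellinger d (mix_pmf d b (Qh X)) (mix_pmf d b Q0) \<le> 1"
        if "X \<in> set_pmf (sample_pmf d b Q0 n)" for X
      proof -
        have "admissible_mixing d b (Qh X)" using mle that by (auto simp: is_npmle_def)
        then have "pmf (embed_pmf (mix_pmf d b (Qh X))) = mix_pmf d b (Qh X)"
          by (intro pmf_embed_mix_pmf psd_coeff_pos[OF asm])
        then show ?thesis
          using hell_pmf_le_1[of "embed_pmf (mix_pmf d b (Qh X))" "embed_pmf (mix_pmf d b Q0)" "{ks. length ks = d}"]
          by (simp add: hell_pmf_embed_mix_pmf[OF psd_coeff_pos[OF asm] psd_admissible[OF asm]])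
      qed
      then have "AE X in sample_pmf d b Q0 n. X \<notin> {X. hellinger d (mix_pmf d b (Qh X)) (mix_pmf d b Q0)
        > L * ln (real n * real d) powr (1 + real d / 2) / sqrt (real n)}"
        using False by (intro AE_pmfI) force
      then have "?p = 0" by (subst measure_pmf.prob_eq_0) auto
      moreover have "0 \<le> ?r" using L A by simp
      ultimately show ?thesis by simp
    qed
  qed
  then show ?thesis by (simp add: A_def)
qed

end

theorem theorem1:
  shows "\<exists>C>0. \<forall>d b (Q0 :: (nat \<Rightarrow> real) measure) q0 M \<delta>0 \<eta>0 V.
    psd_assumptions d b Q0 q0 M \<delta>0 \<eta>0 V \<longrightarrow>
    (let t0 = t0_const b q0; \<theta>t = theta_tilde b q0 M in
      (\<forall>L>2. \<forall>n. real n \<ge> N_const d b t0 \<theta>t \<delta>0 \<eta>0 V \<longrightarrow>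
         (\<forall>Qh. (\<forall>X\<in>set_pmf (sample_pmf d b Q0 n). is_npmle d b n X (Qh X)) \<longrightarrow>
            measure_pmf.prob (sample_pmf d b Q0 n)
              {X. hellinger d (mix_pmf d b (Qh X)) (mix_pmf d b Q0)
                    > L * ln (real n * real d) powr (1 + real d / 2) / sqrt (real n)}
            \<le> 1 / ((L^2 / 2 - 2)^2 * ln (real n * real d) powr (2 + real d))
               + C / L * (real d * 3 ^ d / ln (1 / t0) powr (1 + real d / 2))
                 * (1 + 1 / ln (1 / t0) powr (1 + real d / 2)))) \<and>
      (\<forall>\<epsilon>>0. \<exists>K>0. \<exists>n0. \<forall>n\<ge>n0.
         \<forall>Qh. (\<forall>X\<in>set_pmf (sample_pmf d b Q0 n). is_npmle d b n X (Qh X)) \<longrightarrow>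
            measure_pmf.prob (sample_pmf d b Q0 n)
              {X. hellinger d (mix_pmf d b (Qh X)) (mix_pmf d b Q0)
                    > K * ln (real n * real d) powr (1 + real d / 2) / sqrt (real n)} \<le> \<epsilon>))"
proof (intro exI[of _ 8] conjI allI impI, goal_cases)
  case (2 d b Q0 q0 M \<delta>0 \<eta>0 V)
  define t0 where "t0 = t0_const b q0"
  define \<theta>t where "\<theta>t = theta_tilde b q0 M"
  define D where "D = (real d * 3 ^ d / ln (1 / t0) powr (1 + real d / 2)) * (1 + 1 / ln (1 / t0) powr (1 + real d / 2))"
  note rate = npmle_rate[OF 2, folded t0_def \<theta>t_def]
  have "0 \<le> D" by (simp add: D_def)
  show ?case
    unfolding Let_def t0_def[symmetric] \<theta>t_def[symmetric]
  proof (intro conjI allI impI, goal_cases)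
    case (1 L n Qh)
    show ?case
      \<comment> \<open>The bound of \<open>npmle_rate\<close> is already the second summand, and
        the first one is nonnegative.\<close>
      using rate[OF 1(2,1,3)] by (rule order_trans) simp
  next
    case (2 \<epsilon>)
    \<comment> \<open>The second term of \<open>K\<close> makes \<open>8 / K * D\<close> at most
      \<open>\<epsilon>\<close>, and the 3 keeps \<open>K\<close> above 2 even if \<open>D\<close>
      is small. Neither depends on \<open>n\<close>.\<close>
    define K where "K = 3 + 8 * D / \<epsilon>"
    have K: "K > 2" unfolding K_def using \<open>0 \<le> D\<close> \<open>\<epsilon> > 0\<close> by (simp add: add_pos_nonneg)
    have "8 / K * D \<le> \<epsilon>"
    proof -
      have "8 * D \<le> \<epsilon> * K" unfolding K_def using \<open>\<epsilon> > 0\<close> by (simp add: field_simps)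
      then show ?thesis using K by (simp add: field_simps)
    qed
    show ?case
    proof (rule exI[of _ K], intro conjI exI[of _ "nat \<lceil>N_const d b t0 \<theta>t \<delta>0 \<eta>0 V\<rceil>"] allI impI)
      show "0 < K" using K by simp
      fix n Qh
      assume n: "nat \<lceil>N_const d b t0 \<theta>t \<delta>0 \<eta>0 V\<rceil> \<le> n"
        and mle: "\<forall>X\<in>set_pmf (sample_pmf d b Q0 n). is_npmle d b n X (Qh X)"
      have "N_const d b t0 \<theta>t \<delta>0 \<eta>0 V \<le> real n" using n by linarith
      from rate[OF this K mle]
      show "measure_pmf.prob (sample_pmf d b Q0 n)
              {X. hellinger d (mix_pmf d b (Qh X)) (mix_pmf d b Q0)
                    > K * ln (real n * real d) powr (1 + real d / 2) / sqrt (real n)} \<le> \<epsilon>"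
        using \<open>8 / K * D \<le> \<epsilon>\<close> unfolding D_def by (simp only: mult.assoc)
    qed
  qed
qed simp

end
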